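(* Let $\alpha>0$, let $u,v,\varphi\in H(\mathbb{D})$ with $\varphi(\mathbb{D})\subseteq\mathbb{D}$, and suppose $T_{u,v,\varphi}:B_1\to\mathcal{Z}_\alpha$ is bounded. Then $$\|T_{u,v,\varphi}\|_e\approx\max_{1\le j\le4}\limsup_{|a|\to1}\|T_{u,v,\varphi}f_{j,a}\|_{\mathcal{Z}_\alpha}$$ $$\approx\limsup_{|\varphi(z)|\to1}(1-|z|^2)^\alpha\Big(|u''(z)|+\frac{|(2u'\varphi'+u\varphi''+v'')(z)|}{1-|\varphi(z)|^2}\Big)$$ $$\qquad+\limsup_{|\varphi(z)|\to1}(1-|z|^2)^\alpha\Big(\frac{|(u(\varphi')^2+2v'\varphi'+v\varphi'')(z)|}{(1-|\varphi(z)|^2)^2}+\frac{|(v(\varphi')^2)(z)|}{(1-|\varphi(z)|^2)^3}\Big).$$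
   Context: $\mathbb{D}$ is the open unit disc and $H(\mathbb{D})$ the space of analytic functions on $\mathbb{D}$. For $\alpha>0$, $\mathcal{Z}_\alpha$ consists of $f\in H(\mathbb{D})$ with $\sup_{z}(1-|z|^2)^\alpha|f''(z)|<\infty$, with norm $\|f\|_{\mathcal{Z}_\alpha}=|f(0)|+|f'(0)|+\sup_{z}(1-|z|^2)^\alpha|f''(z)|$. $B_1$ (minimal Möbius invariant space) is the space of $f=\sum_k c_k\sigma_{a_k}$, $a_k\in\mathbb{D}$, $\sum|c_k|<\infty$, $\sigma_a(z)=\frac{a-z}{1-\bar az}$, with norm the infimum of $\sum|c_k|$; equivalently $f\in H(\mathbb{D})$ with $f''\in L^1(\mathbb{D},dA)$, norm comparable to $|f(0)|+|f'(0)|+\int_{\mathbb{D}}|f''|dA$. $T_{u,v,\varphi}f(z)=u(z)f(\varphi(z))+v(z)f'(\varphi(z))$. For $j\in\mathbb{N}$, $a\in\mathbb{D}$: $f_{j,a}(z)=\left(\frac{1-|a|^2}{1-\bar az}\right)^j$. The essential norm of a bounded operator $T:X\to Y$ is $\|T\|_e=\inf\{\|T-K\|: K\text{ compact}\}$. $A\approx B$ means $cB\le A\le CB$ for positive constants $c,C$. *)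

theory Defs
  imports "HOL-Analysis.Analysis"
begin

text \<open>Unit disc; functions on the disc are represented by total functions
  complex => complex whose values off the disc are irrelevant.\<close>

abbreviation disc :: "complex set" where "disc \<equiv> ball 0 1"

text \<open>Minimal Moebius invariant space B_1, via the equivalent (comparable) norm
  |f(0)| + |f'(0)| + int_D |f''| dA, with dA the normalized area measure.\<close>

definition B1 :: "(complex \<Rightarrow> complex) set" where
  "B1 = {f. f holomorphic_on disc \<and>
            set_integrable lborel disc (\<lambda>z. cmod (deriv (deriv f) z))}"

definition B1_norm :: "(complex \<Rightarrow> complex) \<Rightarrow> real" where
  "B1_norm f = cmod (f 0) + cmod (deriv f 0)
     + (1 / pi) * (LINT z : disc | lborel. cmod (deriv (deriv f) z))"

definition Zweight :: "real \<Rightarrow> (complex \<Rightarrow> complex) \<Rightarrow> complex \<Rightarrow> real" where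
  "Zweight \<alpha> f z = (1 - (cmod z)\<^sup>2) powr \<alpha> * cmod (deriv (deriv f) z)"

definition Zspace :: "real \<Rightarrow> (complex \<Rightarrow> complex) set" where
  "Zspace \<alpha> = {f. f holomorphic_on disc \<and> bdd_above (Zweight \<alpha> f ` disc)}"

definition Z_norm :: "real \<Rightarrow> (complex \<Rightarrow> complex) \<Rightarrow> real" where
  "Z_norm \<alpha> f = cmod (f 0) + cmod (deriv f 0) + (SUP z\<in>disc. Zweight \<alpha> f z)"

definition Tuvphi ::
  "(complex \<Rightarrow> complex) \<Rightarrow> (complex \<Rightarrow> complex) \<Rightarrow> (complex \<Rightarrow> complex)
    \<Rightarrow> (complex \<Rightarrow> complex) \<Rightarrow> (complex \<Rightarrow> complex)" where
  "Tuvphi u v \<phi> f = (\<lambda>z. u z * f (\<phi> z) + v z * deriv f (\<phi> z))"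

definition bounded_B1_Z ::
  "real \<Rightarrow> ((complex \<Rightarrow> complex) \<Rightarrow> (complex \<Rightarrow> complex)) \<Rightarrow> bool" where
  "bounded_B1_Z \<alpha> T \<longleftrightarrow> (\<forall>f\<in>B1. T f \<in> Zspace \<alpha>) \<and>
     (\<exists>M. \<forall>f\<in>B1. Z_norm \<alpha> (T f) \<le> M * B1_norm f)"

definition compact_B1_Z ::
  "real \<Rightarrow> ((complex \<Rightarrow> complex) \<Rightarrow> (complex \<Rightarrow> complex)) \<Rightarrow> bool" where
  "compact_B1_Z \<alpha> K \<longleftrightarrow> (\<forall>f\<in>B1. K f \<in> Zspace \<alpha>) \<and>
     (\<forall>f\<in>B1. \<forall>g\<in>B1. \<forall>a b. \<forall>z\<in>disc.
        K (\<lambda>w. a * f w + b * g w) z = a * K f z + b * K g z) \<and>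
     (\<forall>F :: nat \<Rightarrow> complex \<Rightarrow> complex. (\<forall>n. F n \<in> B1) \<and> bounded (range (\<lambda>n. B1_norm (F n))) \<longrightarrow>
        (\<exists>r g. strict_mono r \<and> g \<in> Zspace \<alpha> \<and>
           (\<lambda>n. Z_norm \<alpha> (\<lambda>z. K (F (r n)) z - g z)) \<longlonglongrightarrow> 0))"

definition opnorm_B1_Z ::
  "real \<Rightarrow> ((complex \<Rightarrow> complex) \<Rightarrow> (complex \<Rightarrow> complex)) \<Rightarrow> real" where
  "opnorm_B1_Z \<alpha> S = Sup {Z_norm \<alpha> (S f) | f. f \<in> B1 \<and> B1_norm f \<le> 1}"

definition ess_norm_B1_Z ::
  "real \<Rightarrow> ((complex \<Rightarrow> complex) \<Rightarrow> (complex \<Rightarrow> complex)) \<Rightarrow> real" where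
  "ess_norm_B1_Z \<alpha> T =
     Inf {opnorm_B1_Z \<alpha> (\<lambda>f z. T f z - K f z) | K. compact_B1_Z \<alpha> K}"

definition test_fn :: "nat \<Rightarrow> complex \<Rightarrow> complex \<Rightarrow> complex" where
  "test_fn j a = (\<lambda>z. ((1 - (cmod a)\<^sup>2) / (1 - cnj a * z)) ^ j)"

text \<open>limsup with the convention that it is 0 when the filter is trivial
  (all quantities involved are nonnegative).\<close>

definition limsup0 :: "'a filter \<Rightarrow> ('a \<Rightarrow> ereal) \<Rightarrow> ereal" where
  "limsup0 F g = max 0 (Limsup F g)"

definition to_boundary :: "complex filter" where
  "to_boundary = filtercomap cmod (at_left 1)"

definition phi_to_boundary :: "(complex \<Rightarrow> complex) \<Rightarrow> complex filter" where
  "phi_to_boundary \<phi> = inf (filtercomap (\<lambda>z. cmod (\<phi> z)) (at_left 1)) (principal disc)"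

end

theory Submission
  imports Defs "HOL-Complex_Analysis.Complex_Analysis"
begin

text \<open>For \<open>f\<close> in \<open>B1\<close> the area mean value property of \<open>f''\<close> gives \<open>|f\<^sup>(\<^sup>i\<^sup>)(w)| \<le> C \<parallel>f\<parallel> / (1 - |w|\<^sup>2)\<^sup>i\<close>
  for \<open>i \<le> 3\<close>. Comparing \<open>T f\<close> with the compact operator \<open>f \<mapsto> T (f(r\<cdot>))\<close> and letting \<open>r \<rightarrow> 1\<close>
  bounds the essential norm by the limsup of the coefficients of \<open>(T f)''\<close>. Evaluating \<open>(T f)''\<close> on
  the four test functions peaking at \<open>\<phi> z\<close> gives a nonsingular \<open>4 \<times> 4\<close> system for these coefficients,
  so they are controlled by the test functions. Finally the test functions bound the essential norm from
  below. They do not tend to \<open>0\<close> weakly in \<open>B1\<close>, so \<open>K f\<close> need not become small along them for a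
  compact \<open>K\<close>; instead one uses differences of two test functions, whose images under \<open>K\<close> cluster
  in norm while their images under \<open>T\<close> tend to \<open>0\<close> pointwise.\<close>

section \<open>Area mean value inequality\<close>

text \<open>Among the growth bounds only the one for \<open>f\<close> itself is delicate.
  Integrating |f''| <= C / (1 - |w|)^2 twice along a radius leaves a logarithm, so boundedness of
  \<open>f\<close> has to come from the area integral of |f''| itself: discs of radius (1 - t) / 2
  around the points of a radius sweep out a cone, and each point of the cone is covered for a range
  of t whose length is comparable to 1 - t. The three quantities are compared in a cycle: test
  functions against essential norm, essential norm against coefficients, coefficients against test
  functions. All constants are numerical; the bound of \<open>T\<close> only decides how close r
  must be to 1 and how fast auxiliary sequences decay. The order of choices matters twice. Above, a
  level for |\<phi>| is fixed before r: below the level the 3-jet of f - f(r.) is small, beyond it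
  only growth bounds uniform in r remain. Below, limits are taken at a fixed point z and the
  supremum over z comes last, since the norms of \<open>T\<close> on the test functions need not
  tend to 0.\<close>

lemma lborel_complex_eq: "(lborel :: complex measure) = distr (lborel :: (real \<times> real) measure) borel (\<lambda>(x, y). Complex x y)"
proof (rule lborel_eqI)
  have meas: "(\<lambda>(x, y). Complex x y) \<in> borel_measurable (borel :: (real \<times> real) measure)"
    by (auto intro!: borel_measurable_continuous_onI continuous_intros simp: case_prod_beta Complex_eq)
  fix l u :: complex
  assume le: "\<And>b. b \<in> Basis \<Longrightarrow> l \<bullet> b \<le> u \<bullet> b"
  have le': "Re l \<le> Re u" "Im l \<le> Im u"
    using le[of 1] le[of \<i>] by (auto simp: Basis_complex_def)
  \<comment> \<open>Lebesgue measure is determined by its values on boxes, and a complex box pulls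
    back to a product of two intervals.\<close>
  have "(\<lambda>(x, y). Complex x y) -` box l u = box (Re l) (Re u) \<times> box (Im l) (Im u)"
    by (auto simp: box_def Basis_complex_def)
  then have "emeasure (distr lborel borel (\<lambda>(x, y). Complex x y)) (box l u)
      = emeasure (lborel \<Otimes>\<^sub>M lborel) (box (Re l) (Re u) \<times> box (Im l) (Im u))"
    using meas by (simp add: emeasure_distr lborel_prod)
  also have "\<dots> = emeasure lborel (box (Re l) (Re u)) * emeasure lborel (box (Im l) (Im u))"
    by (intro lborel.emeasure_pair_measure_Times) auto
  also have "\<dots> = (\<Prod>b\<in>Basis. (u - l) \<bullet> b)"
    using le' by (simp add: Basis_complex_def ennreal_mult)
  finally show "emeasure (distr lborel borel (\<lambda>(x, y). Complex x y)) (box l u) = (\<Prod>b\<in>Basis. (u - l) \<bullet> b)" .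
qed simp

section \<open>Tonelli on the complex plane; invariance under shears, rotations and
  translations\<close>

lemma measurable_Complex [measurable]: "(\<lambda>(x, y). Complex x y) \<in> borel_measurable (borel \<Otimes>\<^sub>M borel)"
  unfolding borel_prod
  by (auto intro!: borel_measurable_continuous_onI continuous_intros simp: case_prod_beta Complex_eq)

lemma nn_integral_lborel_complex:
  assumes [measurable]: "f \<in> borel_measurable borel"
  shows "(\<integral>\<^sup>+z. f z \<partial>lborel) = (\<integral>\<^sup>+x. \<integral>\<^sup>+y. f (Complex x y) \<partial>lborel \<partial>lborel)"
proof -
  have "(\<integral>\<^sup>+z. f z \<partial>lborel) = (\<integral>\<^sup>+p. f (case p of (x, y) \<Rightarrow> Complex x y) \<partial>(lborel \<Otimes>\<^sub>M lborel))"
    by (subst lborel_complex_eq, subst nn_integral_distr) (auto simp: lborel_prod borel_prod[symmetric])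
  also have "\<dots> = (\<integral>\<^sup>+x. \<integral>\<^sup>+y. f (Complex x y) \<partial>lborel \<partial>lborel)"
    by (subst lborel.nn_integral_fst[symmetric]) auto
  finally show ?thesis .
qed

lemma nn_integral_lborel_complex':
  assumes [measurable]: "f \<in> borel_measurable borel"
  shows "(\<integral>\<^sup>+z. f z \<partial>lborel) = (\<integral>\<^sup>+y. \<integral>\<^sup>+x. f (Complex x y) \<partial>lborel \<partial>lborel)"
  unfolding nn_integral_lborel_complex[OF assms]
  by (subst lborel_pair.Fubini') auto

text \<open>With \<open>Im z\<close> fixed the shear is a translation of \<open>Re z\<close>, so the
  real part is integrated first.\<close>

lemma nn_integral_shear_Re:
  assumes [measurable]: "f \<in> borel_measurable borel"
  shows "(\<integral>\<^sup>+z. f (Complex (Re z + t * Im z) (Im z)) \<partial>lborel) = (\<integral>\<^sup>+z. f z \<partial>lborel)"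
proof -
  have [measurable]: "(\<lambda>z. f (Complex (Re z + t * Im z) (Im z))) \<in> borel_measurable borel"
    by (simp add: Complex_eq)
  have "(\<integral>\<^sup>+x. f (Complex x y) \<partial>lborel) = (\<integral>\<^sup>+x. f (Complex (t * y + 1 * x) y) \<partial>lborel)" for y
    by (subst nn_integral_real_affine[where c = 1 and t = "t * y"]) auto
  then show ?thesis
    by (simp add: nn_integral_lborel_complex' add.commute)
qed

lemma nn_integral_shear_Im:
  assumes [measurable]: "f \<in> borel_measurable borel"
  shows "(\<integral>\<^sup>+z. f (Complex (Re z) (Im z + t * Re z)) \<partial>lborel) = (\<integral>\<^sup>+z. f z \<partial>lborel)"
proof -
  have [measurable]: "(\<lambda>z. f (Complex (Re z) (Im z + t * Re z))) \<in> borel_measurable borel"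
    by (simp add: Complex_eq)
  have "(\<integral>\<^sup>+y. f (Complex x y) \<partial>lborel) = (\<integral>\<^sup>+y. f (Complex x (t * x + 1 * y)) \<partial>lborel)" for x
    by (subst nn_integral_real_affine[where c = 1 and t = "t * x"]) auto
  then show ?thesis
    by (simp add: nn_integral_lborel_complex add.commute)
qed

text \<open>A rotation other than by \<open>\<pi>\<close> is the composition of three shears.\<close>

lemma nn_integral_rotate:
  fixes f :: "complex \<Rightarrow> ennreal"
  assumes [measurable]: "f \<in> borel_measurable borel" and c: "cmod c = 1"
  shows "(\<integral>\<^sup>+z. f (c * z) \<partial>lborel) = (\<integral>\<^sup>+z. f z \<partial>lborel)"
proof -
  have *: "(\<integral>\<^sup>+z. f (c * z) \<partial>lborel) = (\<integral>\<^sup>+z. f z \<partial>lborel)"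
    if c: "cmod c = 1" "c \<noteq> -1" and [measurable]: "f \<in> borel_measurable borel" for f :: "complex \<Rightarrow> ennreal" and c
  proof -
    define p q where "p = Re c" and "q = Im c"
    have pq: "p\<^sup>2 + q\<^sup>2 = 1" "c = Complex p q"
      using c by (simp_all add: p_def q_def cmod_def)
    have p: "1 + p \<noteq> 0"
    proof
      assume "1 + p = 0"
      then have "p = -1" by linarith
      then have "q = 0" using pq by simp
      note \<open>p = -1\<close> this
      with pq(2) c(2) show False by (simp add: complex_eq_iff)
    qed
    \<comment> \<open>For \<open>c\<close> = exp(i theta) this is -tan(theta / 2), the parameter of
      the two outer shears; the middle one has parameter \<open>q\<close> = sin theta.
      \<open>t1\<close> and \<open>t2\<close> are entries of the product of the three
      matrices.\<close>
    define t where "t = - q / (1 + p)"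
    have t1: "1 + t * q = p" using p pq(1) by (simp add: t_def field_simps power2_eq_square)
    have t2: "t + (1 + t * q) * t = - q"
    proof -
      have "t * (1 + p) = - q" using p by (simp add: t_def)
      then show ?thesis unfolding t1 by (simp add: algebra_simps)
    qed
    define f1 where "f1 = (\<lambda>z. f (Complex (Re z + t * Im z) (Im z)))"
    define f2 where "f2 = (\<lambda>z. f1 (Complex (Re z) (Im z + q * Re z)))"
    have [measurable]: "f1 \<in> borel_measurable borel" by (simp add: f1_def Complex_eq)
    have [measurable]: "f2 \<in> borel_measurable borel" by (simp add: f2_def Complex_eq)
    have "f (c * z) = f2 (Complex (Re z + t * Im z) (Im z))" for z
    proof -
      have "p * Re z - q * Im z = (1 + t * q) * Re z + (t + (1 + t * q) * t) * Im z"
        using t1 t2 by simp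
      then have "p * Re z - q * Im z = Re z + t * Im z + t * (Im z + q * (Re z + t * Im z))"
        by (simp add: algebra_simps)
      moreover have "p * Im z + q * Re z = (1 + t * q) * Im z + q * Re z"
        using t1 by simp
      then have "p * Im z + q * Re z = Im z + q * (Re z + t * Im z)"
        by (simp add: algebra_simps)
      moreover have "c * z = Complex (p * Re z - q * Im z) (p * Im z + q * Re z)"
        by (simp add: pq(2) complex_eq_iff)
      ultimately show ?thesis by (simp add: f1_def f2_def)
    qed
    then have "(\<integral>\<^sup>+z. f (c * z) \<partial>lborel) = (\<integral>\<^sup>+z. f2 z \<partial>lborel)"
      by (simp add: nn_integral_shear_Re)
    also have "\<dots> = (\<integral>\<^sup>+z. f1 z \<partial>lborel)"
      unfolding f2_def by (rule nn_integral_shear_Im) simp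
    also have "\<dots> = (\<integral>\<^sup>+z. f z \<partial>lborel)"
      unfolding f1_def by (rule nn_integral_shear_Re) simp
    finally show ?thesis .
  qed
  show ?thesis
  proof (cases "c = -1")
    \<comment> \<open>Here the denominator 1 + p of \<open>t\<close> vanishes; the half turn is
      taken as two quarter turns.\<close>
    case True
    have "(\<integral>\<^sup>+z. f (c * z) \<partial>lborel) = (\<integral>\<^sup>+z. f (\<i> * (\<i> * z)) \<partial>lborel)"
      by (simp add: True mult.assoc[symmetric])
    also have "\<dots> = (\<integral>\<^sup>+z. f (\<i> * z) \<partial>lborel)"
      by (rule *[where f = "\<lambda>z. f (\<i> * z)"]) (auto simp: complex_eq_iff)
    also have "\<dots> = (\<integral>\<^sup>+z. f z \<partial>lborel)"
      by (rule *) (auto simp: complex_eq_iff)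
    finally show ?thesis .
  qed (use * c in auto)
qed

lemma nn_integral_translate:
  fixes f :: "complex \<Rightarrow> ennreal"
  assumes [measurable]: "f \<in> borel_measurable borel"
  shows "(\<integral>\<^sup>+z. f (w + z) \<partial>lborel) = (\<integral>\<^sup>+z. f z \<partial>lborel)"
  by (subst (2) lborel_distr_plus[symmetric, of w]) (simp add: nn_integral_distr)

text \<open>Cauchy's formula on the unit circle for xi |-> g(xi z), holomorphic on the closed unit
  disc because |xi z| <= |z| < R. \<open>G\<close> is a Borel function on the whole plane standing
  for |g|, which is uncontrolled off the ball; measurability is what Tonelli needs
  afterwards.\<close>

lemma circle_mean_le:
  assumes g: "g holomorphic_on ball 0 R" and z: "z \<in> ball 0 R"
    and G: "G \<in> borel_measurable borel" "\<And>z. z \<in> ball 0 R \<Longrightarrow> G z = cmod (g z)" "\<And>z. G z \<ge> 0"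
  shows "ennreal (cmod (g 0)) \<le> (\<integral>\<^sup>+\<theta>. ennreal (G (exp (2 * of_real pi * \<i> * of_real \<theta>) * z)) * indicator {0..1} \<theta> \<partial>lborel)"
proof -
  define h where "h = (\<lambda>\<xi>. g (\<xi> * z))"
  have sub: "\<xi> * z \<in> ball 0 R" if "cmod \<xi> \<le> 1" for \<xi>
    using mult_right_mono[OF that, of "cmod z"] z by (auto simp: norm_mult)
  have h: "h holomorphic_on cball 0 1"
    unfolding h_def by (intro holomorphic_on_compose_gen[OF _ g, unfolded o_def] holomorphic_intros) (use sub in auto)
  have "((\<lambda>u. h u / (u - 0)) has_contour_integral (2 * of_real pi * \<i> * h 0)) (circlepath 0 1)"
    by (rule Cauchy_integral_circlepath_simple[OF h]) simp
  then have "((\<lambda>x. 2 * of_real pi * \<i> * h (exp (2 * of_real pi * \<i> * of_real x))) has_integral (2 * of_real pi * \<i> * h 0)) {0..1}"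
    unfolding has_contour_integral_def
  proof (rule has_integral_eq[rotated])
    fix x :: real assume x: "x \<in> {0..1}"
    have e: "circlepath 0 1 x = exp (2 * of_real pi * \<i> * of_real x)"
      by (simp add: circlepath_def part_circlepath_def linepath_def mult_ac)
    show "h (circlepath 0 1 x) / (circlepath 0 1 x - 0) * vector_derivative (circlepath 0 1) (at x within {0..1})
        = 2 * of_real pi * \<i> * h (exp (2 * of_real pi * \<i> * of_real x))"
      using x by (simp add: vector_derivative_circlepath01) (simp add: e)
  qed
  from has_integral_mult_right[OF this, of "inverse (2 * of_real pi * \<i>)"]
  have 1: "((\<lambda>x. h (exp (2 * of_real pi * \<i> * of_real x))) has_integral h 0) {0..1}"
    by (simp add: field_simps)
  have cont: "continuous_on {0..1} (\<lambda>x. h (exp (2 * of_real pi * \<i> * of_real x)))"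
    by (rule continuous_on_compose2[OF holomorphic_on_imp_continuous_on[OF h]])
       (auto intro!: continuous_intros simp: norm_exp_eq_Re)
  have "(\<lambda>x. cmod (h (exp (2 * of_real pi * \<i> * of_real x)))) integrable_on {0..1}"
    by (intro integrable_continuous_interval continuous_intros cont)
  then obtain I where I: "((\<lambda>x. cmod (h (exp (2 * of_real pi * \<i> * of_real x)))) has_integral I) {0..1}"
    by blast
  have "cmod (h 0) \<le> I"
    using integral_norm_bound_integral[OF has_integral_integrable[OF 1] has_integral_integrable[OF I]] 1 I
    by (simp add: integral_unique)
  also have "ennreal I = (\<integral>\<^sup>+\<theta>. ennreal (cmod (h (exp (2 * of_real pi * \<i> * of_real \<theta>)))) * indicator {0..1} \<theta> \<partial>lborel)"
    by (rule nn_integral_has_integral_lebesgue'[OF _ I, symmetric]) auto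
  also have "\<dots> = (\<integral>\<^sup>+\<theta>. ennreal (G (exp (2 * of_real pi * \<i> * of_real \<theta>) * z)) * indicator {0..1} \<theta> \<partial>lborel)"
  proof (intro nn_integral_cong)
    fix \<theta> :: real
    have "exp (2 * of_real pi * \<i> * of_real \<theta>) * z \<in> ball 0 R"
      by (rule sub) (simp add: norm_exp_eq_Re)
    then show "ennreal (cmod (h (exp (2 * of_real pi * \<i> * of_real \<theta>)))) * indicator {0..1} \<theta>
        = ennreal (G (exp (2 * of_real pi * \<i> * of_real \<theta>) * z)) * indicator {0..1} \<theta>"
      unfolding h_def by (simp only: G(2))
  qed
  finally show ?thesis by (simp add: h_def ennreal_leI)
qed

text \<open>Polar coordinates are avoided: the circle inequality is integrated over all
  \<open>z\<close> in the ball and the integrals are exchanged; for every angle the rotation leaves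
  the plane integral of \<open>G\<close> unchanged, so the average over angles disappears.\<close>

lemma submean_value:
  assumes g: "g holomorphic_on ball w R" and R: "R > 0"
  shows "ennreal (cmod (g w) * (pi * R\<^sup>2)) \<le> (\<integral>\<^sup>+z. ennreal (cmod (g z)) * indicator (ball w R) z \<partial>lborel)"
proof -
  define h where "h = (\<lambda>z. g (w + z))"
  have h: "h holomorphic_on ball 0 R"
    unfolding h_def by (intro holomorphic_on_compose_gen[OF _ g, unfolded o_def] holomorphic_intros) (auto simp: dist_norm)
  define G where "G = (\<lambda>z. indicator (ball 0 R) z * cmod (h z))"
  have Gm [measurable]: "G \<in> borel_measurable borel"
  proof -
    have "(\<lambda>z. indicator (ball 0 R) z *\<^sub>R cmod (h z)) \<in> borel_measurable borel"
      by (intro borel_measurable_continuous_on_indicator continuous_intros holomorphic_on_imp_continuous_on h) auto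
    then show ?thesis by (simp add: G_def)
  qed
  have Gr: "(\<integral>\<^sup>+z. G (c * z) \<partial>lborel) = (\<integral>\<^sup>+z. G z \<partial>lborel)" if "cmod c = 1" for c
    using that by (intro nn_integral_rotate[where f = "\<lambda>z. ennreal (G z)"]) auto
  have "ennreal (cmod (g w) * (pi * R\<^sup>2)) = (\<integral>\<^sup>+z. ennreal (cmod (g w)) * indicator (ball 0 R) z \<partial>(lborel :: complex measure))"
    using R by (simp add: nn_integral_cmult_indicator emeasure_ball ennreal_mult eval_unit_ball_vol)
  also have "\<dots> \<le> (\<integral>\<^sup>+z. (\<integral>\<^sup>+\<theta>. ennreal (G (exp (2 * of_real pi * \<i> * of_real \<theta>) * z)) * indicator {0..1} \<theta> \<partial>lborel) \<partial>lborel)"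
  proof (rule nn_integral_mono)
    fix z :: complex
    show "ennreal (cmod (g w)) * indicator (ball 0 R) z \<le> (\<integral>\<^sup>+\<theta>. ennreal (G (exp (2 * of_real pi * \<i> * of_real \<theta>) * z)) * indicator {0..1} \<theta> \<partial>lborel)"
      using circle_mean_le[OF h _ Gm, of z] by (auto simp: indicator_def G_def h_def)
  qed
  also have "\<dots> = (\<integral>\<^sup>+\<theta>. (\<integral>\<^sup>+z. ennreal (G (exp (2 * of_real pi * \<i> * of_real \<theta>) * z)) * indicator {0..1} \<theta> \<partial>lborel) \<partial>(lborel :: real measure))"
    by (rule lborel_pair.Fubini') measurable
  also have "\<dots> = (\<integral>\<^sup>+\<theta>. (\<integral>\<^sup>+z. ennreal (G (exp (2 * of_real pi * \<i> * of_real \<theta>) * z)) \<partial>lborel) * indicator {0..1} \<theta> \<partial>(lborel :: real measure))"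
    by (intro nn_integral_cong nn_integral_multc) measurable
  also have "\<dots> = (\<integral>\<^sup>+z. G z \<partial>lborel)"
    by (subst Gr) (auto simp: nn_integral_cmult norm_exp_eq_Re)
  also have "\<dots> = (\<integral>\<^sup>+z. ennreal (cmod (g (w + z))) * indicator (ball w R) (w + z) \<partial>lborel)"
    by (intro nn_integral_cong) (auto simp: G_def h_def indicator_def dist_norm)
  also have "\<dots> = (\<integral>\<^sup>+z. ennreal (cmod (g z)) * indicator (ball w R) z \<partial>lborel)"
  proof (rule nn_integral_translate[where f = "\<lambda>z. ennreal (cmod (g z)) * indicator (ball w R) z"])
    have "(\<lambda>z. indicator (ball w R) z *\<^sub>R cmod (g z)) \<in> borel_measurable borel"
      by (intro borel_measurable_continuous_on_indicator continuous_intros holomorphic_on_imp_continuous_on g) auto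
    then have "(\<lambda>z. ennreal (indicator (ball w R) z *\<^sub>R cmod (g z))) \<in> borel_measurable borel" by measurable
    then show "(\<lambda>z. ennreal (cmod (g z)) * indicator (ball w R) z) \<in> borel_measurable borel"
      by (rule measurable_cong[THEN iffD1, rotated]) (auto simp: indicator_def)
  qed
  finally show ?thesis .
qed

section \<open>Pointwise estimates\<close>

lemma holomorphic_deriv_disc:
  "f holomorphic_on disc \<Longrightarrow> deriv f holomorphic_on disc"
  by (simp add: holomorphic_deriv)

lemma B1_holo: "f \<in> B1 \<Longrightarrow> f holomorphic_on disc"
  by (simp add: B1_def)

lemma B1_norm_ge: "cmod (f 0) + cmod (deriv f 0) \<le> B1_norm f"
proof -
  have "(LINT z : disc | lborel. cmod (deriv (deriv f) z)) \<ge> 0"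
    unfolding set_lebesgue_integral_def by (rule Bochner_Integration.integral_nonneg) auto
  then show ?thesis by (simp add: B1_norm_def)
qed

lemma B1_norm_nonneg: "B1_norm f \<ge> 0"
  using B1_norm_ge[of f] order_trans[OF add_nonneg_nonneg[OF norm_ge_zero norm_ge_zero]] by blast

lemma B1_nn_integral_le:
  assumes "f \<in> B1"
  shows "(\<integral>\<^sup>+z. ennreal (cmod (deriv (deriv f) z)) * indicator disc z \<partial>lborel)
    \<le> ennreal (pi * (B1_norm f - cmod (f 0) - cmod (deriv f 0)))"
proof -
  have "set_integrable lborel disc (\<lambda>z. cmod (deriv (deriv f) z))"
    using assms by (simp add: B1_def)
  then have i: "integrable lborel (\<lambda>z. indicator disc z *\<^sub>R cmod (deriv (deriv f) z))"
    by (simp add: set_integrable_def)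
  have "(\<integral>\<^sup>+z. ennreal (cmod (deriv (deriv f) z)) * indicator disc z \<partial>lborel)
    = (\<integral>\<^sup>+z. ennreal (indicator disc z *\<^sub>R cmod (deriv (deriv f) z)) \<partial>lborel)"
    by (intro nn_integral_cong) (auto simp: indicator_def)
  also have "\<dots> = ennreal (LINT z : disc | lborel. cmod (deriv (deriv f) z))"
    unfolding set_lebesgue_integral_def by (rule nn_integral_eq_integral[OF i]) auto
  also have "(LINT z : disc | lborel. cmod (deriv (deriv f) z)) = pi * (B1_norm f - cmod (f 0) - cmod (deriv f 0))"
    by (simp add: B1_norm_def)
  finally show ?thesis by simp
qed

lemma B1_nn_integral_le_norm:
  assumes "f \<in> B1"
  shows "(\<integral>\<^sup>+z. ennreal (cmod (deriv (deriv f) z)) * indicator disc z \<partial>lborel) \<le> ennreal (pi * B1_norm f)"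
  by (rule order_trans[OF B1_nn_integral_le[OF assms] ennreal_leI[OF mult_left_mono]])
     (use norm_ge_zero[of "f 0"] norm_ge_zero[of "deriv f 0"] in linarith, simp)

text \<open>Submean value property on the disc of radius 1 - |w|, the largest one around
  \<open>w\<close> inside the unit disc; its factor pi cancels against the normalization of the
  area. The numerator keeps only the integral part of the norm, so that integrating for
  \<open>f'\<close> costs no constant.\<close>

lemma B1_deriv2_bound':
  assumes f: "f \<in> B1" and w: "w \<in> disc"
  shows "cmod (deriv (deriv f) w) \<le> (B1_norm f - cmod (f 0) - cmod (deriv f 0)) / (1 - cmod w)\<^sup>2"
proof -
  define R where "R = 1 - cmod w"
  have R: "R > 0" using w by (simp add: R_def)
  have sub: "ball w R \<subseteq> disc"
    by (auto simp: R_def dist_norm) (metis add.commute diff_add_cancel dist_commute dist_norm less_diff_eq norm_triangle_lt norm_minus_commute)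
  have "ennreal (cmod (deriv (deriv f) w) * (pi * R\<^sup>2))
      \<le> (\<integral>\<^sup>+z. ennreal (cmod (deriv (deriv f) z)) * indicator (ball w R) z \<partial>lborel)"
    by (rule submean_value[OF holomorphic_on_subset[OF _ sub] R])
       (intro holomorphic_deriv_disc B1_holo f)
  also have "\<dots> \<le> (\<integral>\<^sup>+z. ennreal (cmod (deriv (deriv f) z)) * indicator disc z \<partial>lborel)"
    using sub by (intro nn_integral_mono) (auto simp: indicator_def)
  also have "\<dots> \<le> ennreal (pi * (B1_norm f - cmod (f 0) - cmod (deriv f 0)))"
    by (rule B1_nn_integral_le[OF f])
  finally have le: "ennreal (cmod (deriv (deriv f) w) * (pi * R\<^sup>2)) \<le> ennreal (pi * (B1_norm f - cmod (f 0) - cmod (deriv f 0)))" .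
  have "0 \<le> pi * (B1_norm f - cmod (f 0) - cmod (deriv f 0))"
    using B1_norm_ge[of f] by simp
  with le have "cmod (deriv (deriv f) w) * (pi * R\<^sup>2) \<le> pi * (B1_norm f - cmod (f 0) - cmod (deriv f 0))"
    by (simp add: ennreal_le_iff)
  then have "cmod (deriv (deriv f) w) * R\<^sup>2 \<le> B1_norm f - cmod (f 0) - cmod (deriv f 0)"
    using pi_gt_zero by (simp add: mult.left_commute)
  then show ?thesis using R by (simp add: R_def[symmetric] field_simps)
qed

lemma B1_deriv2_bound:
  assumes f: "f \<in> B1" and w: "w \<in> disc"
  shows "cmod (deriv (deriv f) w) \<le> B1_norm f / (1 - cmod w)\<^sup>2"
  by (rule order_trans[OF B1_deriv2_bound'[OF assms] divide_right_mono])
     (use norm_ge_zero[of "f 0"] norm_ge_zero[of "deriv f 0"] in linarith, simp)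

lemma ball_half_subset_disc:
  assumes "w \<in> disc" "x \<in> cball w ((1 - cmod w) / 2)"
  shows "x \<in> disc" "1 - cmod x \<ge> (1 - cmod w) / 2"
proof -
  have "cmod x \<le> cmod w + cmod (x - w)" by (metis add.commute norm_triangle_sub)
  also have "\<dots> \<le> cmod w + (1 - cmod w) / 2" using assms by (simp add: dist_norm norm_minus_commute)
  finally have "cmod x \<le> cmod w + (1 - cmod w) / 2" .
  then show "1 - cmod x \<ge> (1 - cmod w) / 2" by (simp add: field_simps)
  with assms show "x \<in> disc" by (auto simp: field_simps)
qed

lemma Cauchy_estimate:
  assumes "f holomorphic_on S" "open S" "cball w r \<subseteq> S" "r > 0" "\<And>x. x \<in> cball w r \<Longrightarrow> cmod (f x) \<le> B"
  shows "cmod ((deriv ^^ n) f w) \<le> fact n * B / r ^ n"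
proof (rule Cauchy_inequality)
  show "f holomorphic_on ball w r"
    using assms ball_subset_cball by (blast intro: holomorphic_on_subset)
  show "continuous_on (cball w r) f"
    using assms by (blast intro: holomorphic_on_subset holomorphic_on_imp_continuous_on)
qed (use assms in \<open>auto simp: dist_norm\<close>)

text \<open>Cauchy's inequality for \<open>f''\<close> on the disc of radius (1 - |w|) / 2, where 1
  - |x| is at least half of 1 - |w|. Three factors 1/2 in the denominator give 8.\<close>

lemma B1_deriv3_bound:
  assumes f: "f \<in> B1" and w: "w \<in> disc"
  shows "cmod (deriv (deriv (deriv f)) w) \<le> 8 * B1_norm f / (1 - cmod w)^3"
proof -
  define R where "R = (1 - cmod w) / 2"
  have R: "R > 0" using w by (simp add: R_def)
  have "cmod ((deriv ^^ 1) (deriv (deriv f)) w) \<le> fact 1 * (B1_norm f / R\<^sup>2) / R ^ 1"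
  proof (rule Cauchy_estimate)
    show "deriv (deriv f) holomorphic_on disc" by (intro holomorphic_deriv_disc B1_holo f)
    show "cball w R \<subseteq> disc" using ball_half_subset_disc(1)[OF w] by (auto simp: R_def)
    fix x assume "x \<in> cball w R"
    then have x: "x \<in> disc" "1 - cmod x \<ge> R" using ball_half_subset_disc[OF w] by (auto simp: R_def)
    have "cmod (deriv (deriv f) x) \<le> B1_norm f / (1 - cmod x)\<^sup>2" by (rule B1_deriv2_bound[OF f x(1)])
    also have "\<dots> \<le> B1_norm f / R\<^sup>2"
      using x R by (intro divide_left_mono power_mono B1_norm_nonneg) auto
    finally show "cmod (deriv (deriv f) x) \<le> B1_norm f / R\<^sup>2" .
  qed (use R in auto)
  also have "\<dots> = 8 * B1_norm f / (1 - cmod w)^3"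
    by (simp add: R_def power2_eq_square power3_eq_cube)
  finally show ?thesis by simp
qed

lemma complex_polar_unit:
  obtains e where "cmod e = 1" "w = of_real (cmod w) * e"
proof (cases "w = 0")
  case True
  then show ?thesis using that[of 1] by simp
next
  case False
  then show ?thesis using that[of "w / of_real (cmod w)"] by (simp add: norm_divide)
qed

text \<open>Along the radius, N / (1 - t)^2 has the primitive N / (1 - t); the value |f'(0)| is
  absorbed by the part of the norm that \<open>N\<close> leaves out.\<close>

lemma B1_deriv1_bound:
  assumes f: "f \<in> B1" and w: "w \<in> disc"
  shows "cmod (deriv f w) \<le> B1_norm f / (1 - cmod w)"
proof (cases "w = 0")
  case True
  have "cmod (deriv f 0) \<le> B1_norm f"
    using B1_norm_ge[of f] norm_ge_zero[of "f 0"] by linarith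
  then show ?thesis using True by simp
next
  case False
  obtain e where e: "cmod e = 1" "w = of_real (cmod w) * e" by (rule complex_polar_unit)
  define x where "x = cmod w"
  define N where "N = B1_norm f - cmod (f 0) - cmod (deriv f 0)"
  have x: "0 < x" "x < 1" using w False by (auto simp: x_def)
  have d2: "(deriv f has_field_derivative deriv (deriv f) z) (at z)" if "z \<in> disc" for z
    by (rule holomorphic_derivI[OF holomorphic_deriv_disc[OF B1_holo[OF f]] _ that]) simp
  have te: "of_real t * e \<in> disc" if "0 \<le> t" "t \<le> x" for t :: real
    using that x e by (simp add: norm_mult)
  have vd: "((\<lambda>t. deriv f (of_real t * e)) has_vector_derivative deriv (deriv f) (of_real t * e) * e) (at t)"
    if "0 \<le> t" "t \<le> x" for t :: real
  proof (rule has_vector_derivative_real_field)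
    show "((\<lambda>s. deriv f (s * e)) has_field_derivative deriv (deriv f) (of_real t * e) * e) (at (of_real t))"
      by (rule DERIV_chain2[where g = "\<lambda>s. s * e", OF d2[OF te[OF that]]]) (auto intro!: derivative_eq_intros)
  qed
  have "cmod (deriv f (of_real x * e) - deriv f (of_real 0 * e)) \<le> N / (1 - x) - N / (1 - 0)"
  proof (rule differentiable_bound_general[where f = "\<lambda>t. deriv f (of_real t * e)" and \<phi> = "\<lambda>t. N / (1 - t)"
        and f' = "\<lambda>t. deriv (deriv f) (of_real t * e) * e" and \<phi>' = "\<lambda>t. N / (1 - t)\<^sup>2"])
    show "continuous_on {0..x} (\<lambda>t. deriv f (of_real t * e))"
      using vd has_vector_derivative_continuous by (intro continuous_at_imp_continuous_on ballI) force
    show "continuous_on {0..x} (\<lambda>t. N / (1 - t))" using x by (intro continuous_intros) auto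
    fix t assume t: "0 < t" "t < x"
    show "((\<lambda>t. deriv f (of_real t * e)) has_vector_derivative deriv (deriv f) (of_real t * e) * e) (at t)"
      using vd t by simp
    show "((\<lambda>t. N / (1 - t)) has_vector_derivative N / (1 - t)\<^sup>2) (at t)"
      unfolding has_real_derivative_iff_has_vector_derivative[symmetric]
      using t x by (auto intro!: derivative_eq_intros simp: power2_eq_square)
    show "cmod (deriv (deriv f) (of_real t * e) * e) \<le> N / (1 - t)\<^sup>2"
      using B1_deriv2_bound'[OF f te[of t]] t e by (simp add: norm_mult N_def)
  qed (use x in auto)
  then have "cmod (deriv f w - deriv f 0) \<le> N / (1 - x) - N"
    using e by (simp add: x_def)
  moreover have "cmod (deriv f w) \<le> cmod (deriv f 0) + cmod (deriv f w - deriv f 0)"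
    by (metis norm_triangle_sub)
  ultimately have "cmod (deriv f w) \<le> cmod (deriv f 0) + N / (1 - x) - N" by simp
  also have "\<dots> \<le> B1_norm f / (1 - x)"
  proof -
    have 1: "N / (1 - x) = B1_norm f / (1 - x) - (cmod (f 0) + cmod (deriv f 0)) / (1 - x)"
      unfolding N_def by (simp add: diff_divide_distrib add_divide_distrib)
    have 2: "cmod (f 0) + cmod (deriv f 0) \<le> (cmod (f 0) + cmod (deriv f 0)) / (1 - x)"
      using x by (simp add: field_simps mult_nonneg_nonneg)
    have N: "N \<ge> 0" using B1_norm_ge[of f] by (simp add: N_def)
    show ?thesis using 1 2 N norm_ge_zero[of "f 0"] by linarith
  qed
  finally show ?thesis by (simp add: x_def)
qed

text \<open>The points \<open>t * e\<close> whose disc of radius \<open>(1 - t) / 2\<close> contains \<open>\<zeta>\<close> satisfy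
  \<open>2 * d / 3 < 1 - t < 2 * d\<close> with \<open>d = |e - \<zeta>|\<close>, so the singularity at \<open>t = 1\<close> costs only a constant.\<close>

lemma cone_kernel_bound:
  assumes e: "cmod e = 1"
  shows "(\<integral>\<^sup>+t. (if 0 \<le> t \<and> t < 1 \<and> cmod (of_real t * e - \<zeta>) < (1 - t) / 2 then ennreal (4 / (pi * (1 - t))) else 0) \<partial>lborel)
     \<le> ennreal (8 / pi)"
proof -
  define d where "d = cmod (e - \<zeta>)"
  have d: "2 * d / 3 < 1 - t \<and> 1 - t < 2 * d" if "t < 1" "cmod (of_real t * e - \<zeta>) < (1 - t) / 2" for t :: real
  proof -
    have n: "cmod (e - of_real t * e) = 1 - t"
    proof -
      have "e - of_real t * e = of_real (1 - t) * e" by (simp add: algebra_simps)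
      then show ?thesis using e that by (simp only: norm_mult norm_of_real) simp
    qed
    have "d \<le> cmod (e - of_real t * e) + cmod (of_real t * e - \<zeta>)"
      unfolding d_def using norm_triangle_ineq[of "e - of_real t * e" "of_real t * e - \<zeta>"] by simp
    moreover have "cmod (e - of_real t * e) \<le> d + cmod (of_real t * e - \<zeta>)"
      unfolding d_def using norm_triangle_ineq4[of "e - \<zeta>" "of_real t * e - \<zeta>"] by simp
    ultimately show ?thesis using that n by simp
  qed
  show ?thesis
  proof (cases "d > 0")
    case True
    \<comment> \<open>The window for \<open>t\<close> has length 4d / 3 and the kernel is at most 6
      / (pi d) on it; the product 8 / pi does not depend on \<open>d\<close>.\<close>
    have "(\<integral>\<^sup>+t. (if 0 \<le> t \<and> t < 1 \<and> cmod (of_real t * e - \<zeta>) < (1 - t) / 2 then ennreal (4 / (pi * (1 - t))) else 0) \<partial>lborel)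
      \<le> (\<integral>\<^sup>+t. ennreal (6 / (pi * d)) * indicator {1 - 2 * d .. 1 - 2 * d / 3} t \<partial>lborel)"
    proof (rule nn_integral_mono)
      fix t :: real
      show "(if 0 \<le> t \<and> t < 1 \<and> cmod (of_real t * e - \<zeta>) < (1 - t) / 2 then ennreal (4 / (pi * (1 - t))) else 0)
        \<le> ennreal (6 / (pi * d)) * indicator {1 - 2 * d .. 1 - 2 * d / 3} t"
      proof (cases "0 \<le> t \<and> t < 1 \<and> cmod (of_real t * e - \<zeta>) < (1 - t) / 2")
        case t: True
        with d[of t] have dt: "2 * d / 3 < 1 - t" "1 - t < 2 * d" by auto
        have "4 / (pi * (1 - t)) \<le> 4 / (pi * (2 * d / 3))"
          using dt True by (intro divide_left_mono mult_left_mono mult_pos_pos) auto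
        also have "\<dots> = 6 / (pi * d)" by simp
        finally show ?thesis using t dt by (auto simp: indicator_def intro!: ennreal_leI)
      qed auto
    qed
    also have "\<dots> = ennreal (6 / (pi * d)) * ennreal (4 * d / 3)"
      using True by (simp add: nn_integral_cmult_indicator)
    also have "\<dots> = ennreal (8 / pi)"
      using True by (simp add: ennreal_mult[symmetric])
    finally show ?thesis .
  next
    case False
    then have "d = 0" by (simp add: d_def)
    have "\<not> (0 \<le> t \<and> t < 1 \<and> cmod (of_real t * e - \<zeta>) < (1 - t) / 2)" for t :: real
      using d[of t] \<open>d = 0\<close> by auto
    then have "(\<lambda>t. if 0 \<le> t \<and> t < 1 \<and> cmod (of_real t * e - \<zeta>) < (1 - t) / 2 then ennreal (4 / (pi * (1 - t))) else 0) = (\<lambda>_. 0)"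
      by (simp only: if_False)
    then show ?thesis by simp
  qed
qed

text \<open>The submean value property on the disc of radius (1 - t) / 2 turns the integrand into an
  area integral of |f''| against the kernel 4 / (pi (1 - t)) on that disc. After Tonelli the
  \<open>t\<close>-integral of the kernel is at most 8 / pi, and pi times the norm bounds the
  integral of |f''|.\<close>

lemma B1_radial_integral:
  assumes f: "f \<in> B1" and e: "cmod e = 1"
  shows "(\<integral>\<^sup>+t. ennreal ((1 - t) * cmod (deriv (deriv f) (of_real t * e))) * indicator {0..<1} t \<partial>lborel)
     \<le> ennreal (8 * B1_norm f)"
proof -
  define H where "H = (\<lambda>z. ennreal (cmod (deriv (deriv f) z)) * indicator disc z)"
  define k where "k = (\<lambda>t \<zeta>. if 0 \<le> t \<and> t < 1 \<and> cmod (of_real t * e - \<zeta>) < (1 - t) / 2 then ennreal (4 / (pi * (1 - t))) else 0)"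
  have holo: "deriv (deriv f) holomorphic_on disc" by (intro holomorphic_deriv_disc B1_holo f)
  have [measurable]: "H \<in> borel_measurable borel"
  proof -
    have "(\<lambda>z. indicator disc z *\<^sub>R cmod (deriv (deriv f) z)) \<in> borel_measurable borel"
      by (intro borel_measurable_continuous_on_indicator continuous_intros holomorphic_on_imp_continuous_on holo) auto
    then have "(\<lambda>z. ennreal (indicator disc z *\<^sub>R cmod (deriv (deriv f) z))) \<in> borel_measurable borel" by measurable
    then show ?thesis
      by (rule measurable_cong[THEN iffD1, rotated]) (auto simp: indicator_def H_def)
  qed
  have [measurable]: "(\<lambda>(t, \<zeta>). k t \<zeta>) \<in> borel_measurable (borel \<Otimes>\<^sub>M borel)"
    unfolding k_def by measurable
  have "(\<integral>\<^sup>+t. ennreal ((1 - t) * cmod (deriv (deriv f) (of_real t * e))) * indicator {0..<1} t \<partial>lborel)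
     \<le> (\<integral>\<^sup>+t. \<integral>\<^sup>+\<zeta>. k t \<zeta> * H \<zeta> \<partial>lborel \<partial>lborel)"
  proof (rule nn_integral_mono)
    fix t :: real
    show "ennreal ((1 - t) * cmod (deriv (deriv f) (of_real t * e))) * indicator {0..<1} t \<le> (\<integral>\<^sup>+\<zeta>. k t \<zeta> * H \<zeta> \<partial>lborel)"
    proof (cases "t \<in> {0..<1}")
      case True
      define R where "R = (1 - t) / 2"
      have R: "R > 0" using True by (simp add: R_def)
      have te: "cmod (of_real t * e) = t" using e True by (simp add: norm_mult)
      have [measurable]: "ball (of_real t * e) R \<in> sets borel" by simp
      have sub: "ball (of_real t * e) R \<subseteq> disc"
        using ball_half_subset_disc(1)[of "of_real t * e"] te True by (auto simp: R_def)
      have "ennreal ((1 - t) * cmod (deriv (deriv f) (of_real t * e)))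
        = ennreal (4 / (pi * (1 - t))) * ennreal (cmod (deriv (deriv f) (of_real t * e)) * (pi * R\<^sup>2))"
        using True by (subst ennreal_mult[symmetric]) (auto simp: R_def power2_eq_square)
      also have "\<dots> \<le> ennreal (4 / (pi * (1 - t))) * (\<integral>\<^sup>+z. ennreal (cmod (deriv (deriv f) z)) * indicator (ball (of_real t * e) R) z \<partial>lborel)"
        by (intro mult_left_mono submean_value holomorphic_on_subset[OF holo sub] R) auto
      also have "\<dots> = ennreal (4 / (pi * (1 - t))) * (\<integral>\<^sup>+z. H z * indicator (ball (of_real t * e) R) z \<partial>lborel)"
      proof (rule arg_cong2[where f = "(*)", OF refl], rule nn_integral_cong)
        fix z
        show "ennreal (cmod (deriv (deriv f) z)) * indicator (ball (of_real t * e) R) z = H z * indicator (ball (of_real t * e) R) z"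
        proof (cases "z \<in> ball (of_real t * e) R")
          case True
          with sub have "z \<in> disc" by blast
          then show ?thesis by (simp add: H_def)
        qed (simp add: indicator_def)
      qed
      also have "\<dots> = (\<integral>\<^sup>+z. ennreal (4 / (pi * (1 - t))) * (H z * indicator (ball (of_real t * e) R) z) \<partial>lborel)"
        by (rule nn_integral_cmult[symmetric]) measurable
      also have "\<dots> = (\<integral>\<^sup>+z. k t z * H z \<partial>lborel)"
        using True by (intro nn_integral_cong) (auto simp: k_def indicator_def R_def dist_norm)
      finally show ?thesis using True by simp
    qed auto
  qed
  also have "\<dots> = (\<integral>\<^sup>+\<zeta>. \<integral>\<^sup>+t. k t \<zeta> * H \<zeta> \<partial>lborel \<partial>lborel)"
    by (rule lborel_pair.Fubini') measurable
  also have "\<dots> = (\<integral>\<^sup>+\<zeta>. (\<integral>\<^sup>+t. k t \<zeta> \<partial>lborel) * H \<zeta> \<partial>lborel)"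
    by (intro nn_integral_cong nn_integral_multc) measurable
  also have "\<dots> \<le> (\<integral>\<^sup>+\<zeta>. ennreal (8 / pi) * H \<zeta> \<partial>lborel)"
    unfolding k_def by (intro nn_integral_mono mult_right_mono cone_kernel_bound e) auto
  also have "\<dots> = ennreal (8 / pi) * (\<integral>\<^sup>+\<zeta>. H \<zeta> \<partial>lborel)"
    by (rule nn_integral_cmult) simp
  also have "\<dots> \<le> ennreal (8 / pi) * ennreal (pi * B1_norm f)"
    unfolding H_def by (intro mult_left_mono B1_nn_integral_le_norm f) auto
  also have "\<dots> = ennreal (8 * B1_norm f)"
    by (subst ennreal_mult[symmetric]) (auto simp: B1_norm_nonneg)
  finally show ?thesis .
qed

text \<open>Taylor's formula along the radius with integral remainder: f(w) = f(0) + w f'(0) +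
  integral of (x - t) e^2 f''(t e). Since x - t <= 1 - t, the remainder is controlled by the
  weighted radial integral; hence 9 = 8 + 1.\<close>

lemma B1_sup_bound:
  assumes f: "f \<in> B1" and w: "w \<in> disc"
  shows "cmod (f w) \<le> 9 * B1_norm f"
proof -
  obtain e where e: "cmod e = 1" "w = of_real (cmod w) * e" by (rule complex_polar_unit)
  define x where "x = cmod w"
  have x: "0 \<le> x" "x < 1" using w by (auto simp: x_def)
  have d1: "(f has_field_derivative deriv f z) (at z)" if "z \<in> disc" for z
    by (rule holomorphic_derivI[OF B1_holo[OF f] _ that]) simp
  have d2: "(deriv f has_field_derivative deriv (deriv f) z) (at z)" if "z \<in> disc" for z
    by (rule holomorphic_derivI[OF holomorphic_deriv_disc[OF B1_holo[OF f]] _ that]) simp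
  have te: "of_real t * e \<in> disc" if "0 \<le> t" "t \<le> x" for t :: real
    using that x e by (simp add: norm_mult)
  \<comment> \<open>Chosen so that in \<open>p'\<close> the two terms with \<open>f'\<close> cancel
    and only the remainder integrand \<open>q\<close> is left; \<open>p\<close> runs from f(0) + w
    f'(0) to f(w).\<close>
  define p where "p = (\<lambda>s. f (s * e) + (of_real x - s) * e * deriv f (s * e))"
  define q where "q = (\<lambda>t. of_real (x - t) * e\<^sup>2 * deriv (deriv f) (of_real t * e))"
  have "((\<lambda>t. p (of_real t)) has_vector_derivative q t) (at t within {0..x})" if "t \<in> {0..x}" for t
  proof (rule has_vector_derivative_real_field)
    have t: "of_real t * e \<in> disc" using te that by simp
    have 1: "((\<lambda>s. f (s * e)) has_field_derivative deriv f (of_real t * e) * e) (at (of_real t))"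
      by (rule DERIV_chain2[where g = "\<lambda>s. s * e", OF d1[OF t]]) (auto intro!: derivative_eq_intros)
    have 2: "((\<lambda>s. deriv f (s * e)) has_field_derivative deriv (deriv f) (of_real t * e) * e) (at (of_real t))"
      by (rule DERIV_chain2[where g = "\<lambda>s. s * e", OF d2[OF t]]) (auto intro!: derivative_eq_intros)
    show "(p has_field_derivative q t) (at (of_real t))"
      unfolding p_def q_def by (rule derivative_eq_intros 1 2 refl)+ (simp add: algebra_simps power2_eq_square)
  qed
  then have int: "(q has_integral (p (of_real x) - p (of_real 0))) {0..x}"
    using x by (intro fundamental_theorem_of_calculus) auto
  have cont: "continuous_on {0..x} (\<lambda>t. deriv (deriv f) (of_real t * e))"
    by (rule continuous_on_compose2[OF holomorphic_on_imp_continuous_on[OF holomorphic_deriv_disc[OF holomorphic_deriv_disc[OF B1_holo[OF f]]]]])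
       (use te in \<open>auto intro!: continuous_intros\<close>)
  then have "(\<lambda>t. (x - t) * cmod (deriv (deriv f) (of_real t * e))) integrable_on {0..x}"
    by (intro integrable_continuous_interval continuous_intros)
  then obtain J where J: "((\<lambda>t. (x - t) * cmod (deriv (deriv f) (of_real t * e))) has_integral J) {0..x}"
    by blast
  have J0: "J \<ge> 0" using has_integral_nonneg[OF J] by auto
  have "cmod (p (of_real x) - p (of_real 0)) \<le> J"
    using integral_norm_bound_integral[OF has_integral_integrable[OF int] has_integral_integrable[OF J]] int J
    by (auto simp: integral_unique q_def norm_mult norm_power e simp del: of_real_diff)
  have "ennreal J = (\<integral>\<^sup>+t. ennreal ((x - t) * cmod (deriv (deriv f) (of_real t * e))) * indicator {0..x} t \<partial>lborel)"
    by (rule nn_integral_has_integral_lebesgue'[OF _ J, symmetric]) auto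
  also have "\<dots> \<le> (\<integral>\<^sup>+t. ennreal ((1 - t) * cmod (deriv (deriv f) (of_real t * e))) * indicator {0..<1} t \<partial>lborel)"
    using x by (intro nn_integral_mono) (auto simp: indicator_def intro!: ennreal_leI mult_right_mono)
  also have "\<dots> \<le> ennreal (8 * B1_norm f)" by (rule B1_radial_integral[OF f e(1)])
  finally have "J \<le> 8 * B1_norm f" by (simp add: B1_norm_nonneg)
  have fw: "f w = (p (of_real x) - p (of_real 0)) + f 0 + of_real x * e * deriv f 0"
    using e by (simp add: p_def x_def)
  have "cmod (f w) \<le> cmod (p (of_real x) - p (of_real 0)) + cmod (f 0) + cmod (of_real x * e * deriv f 0)"
    unfolding fw
    using norm_triangle_ineq[of "p (of_real x) - p (of_real 0) + f 0" "of_real x * e * deriv f 0"]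
      norm_triangle_ineq[of "p (of_real x) - p (of_real 0)" "f 0"] by linarith
  also have "cmod (of_real x * e * deriv f 0) \<le> cmod (deriv f 0)"
    using x e by (simp add: norm_mult mult_left_le_one_le)
  finally have "cmod (f w) \<le> cmod (p (of_real x) - p (of_real 0)) + cmod (f 0) + cmod (deriv f 0)"
    by simp
  then show ?thesis
    using B1_norm_ge[of f] \<open>cmod (p (of_real x) - p (of_real 0)) \<le> J\<close> \<open>J \<le> 8 * B1_norm f\<close> by linarith
qed

section \<open>Test functions\<close>

lemma deriv_eq_on_disc:
  assumes "\<And>z. z \<in> disc \<Longrightarrow> f z = g z" "z \<in> disc"
  shows "deriv f z = deriv g z"
  by (rule deriv_cong_ev) (use assms in \<open>auto simp: eventually_nhds intro!: exI[of _ disc]\<close>)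

lemma deriv_lincomb_disc:
  assumes f: "f holomorphic_on disc" and g: "g holomorphic_on disc" and z: "z \<in> disc"
  shows "deriv (\<lambda>w. a * f w + b * g w) z = a * deriv f z + b * deriv g z"
proof -
  have "(f has_field_derivative deriv f z) (at z)" "(g has_field_derivative deriv g z) (at z)"
    using holomorphic_derivI[OF f _ z] holomorphic_derivI[OF g _ z] by auto
  then show ?thesis
    by (intro DERIV_imp_deriv) (auto intro!: derivative_eq_intros)
qed

lemma higher_deriv_lincomb_disc:
  assumes f: "f holomorphic_on disc" and g: "g holomorphic_on disc" and z: "z \<in> disc"
  shows "(deriv ^^ n) (\<lambda>w. a * f w + b * g w) z = a * (deriv ^^ n) f z + b * (deriv ^^ n) g z"
  using z
proof (induction n arbitrary: z)
  case (Suc n)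
  have "(deriv ^^ Suc n) (\<lambda>w. a * f w + b * g w) z = deriv (\<lambda>w. a * (deriv ^^ n) f w + b * (deriv ^^ n) g w) z"
    using deriv_eq_on_disc[OF Suc.IH Suc.prems] by simp
  then show ?case
    using deriv_lincomb_disc[of "(deriv ^^ n) f" "(deriv ^^ n) g" z a b] Suc.prems
      holomorphic_higher_deriv[OF f] holomorphic_higher_deriv[OF g] by simp
qed simp

text \<open>The normalized area of the disc is 1, so a bound on \<open>f''\<close> enters the norm
  unchanged. This covers cubic polynomials and dilations; for test functions it yields membership
  only, since their second derivatives are not uniformly bounded in \<open>a\<close>.\<close>

lemma B1_of_bounded_deriv2:
  assumes f: "f holomorphic_on disc" and B: "\<And>z. z \<in> disc \<Longrightarrow> cmod (deriv (deriv f) z) \<le> B"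
  shows "f \<in> B1" "B1_norm f \<le> cmod (f 0) + cmod (deriv f 0) + B"
proof -
  have holo: "deriv (deriv f) holomorphic_on disc" by (intro holomorphic_deriv_disc f)
  have m: "(\<lambda>z. indicator disc z *\<^sub>R cmod (deriv (deriv f) z)) \<in> borel_measurable borel"
    by (intro borel_measurable_continuous_on_indicator continuous_intros holomorphic_on_imp_continuous_on holo) auto
  have fin: "emeasure lborel disc < \<infinity>" by (intro emeasure_bounded_finite bounded_ball)
  have iB: "integrable lborel (\<lambda>z. indicator disc z *\<^sub>R B)"
    using fin by (intro integrable_real_indicator integrable_scaleR_left) auto
  have B0: "B \<ge> 0" using order_trans[OF norm_ge_zero B[of 0]] by simp
  have i: "integrable lborel (\<lambda>z. indicator disc z *\<^sub>R cmod (deriv (deriv f) z))"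
    by (rule Bochner_Integration.integrable_bound[OF iB]) (use m B B0 in \<open>auto simp: indicator_def\<close>)
  then show "f \<in> B1" using f by (simp add: B1_def set_integrable_def)
  have "(LINT z : disc | lborel. cmod (deriv (deriv f) z)) \<le> (LINT z | lborel. indicator disc z *\<^sub>R B)"
    unfolding set_lebesgue_integral_def by (intro integral_mono i iB) (use B in \<open>auto simp: indicator_def\<close>)
  also have "\<dots> = pi * B"
    by (simp add: measure_def emeasure_ball eval_unit_ball_vol)
  finally show "B1_norm f \<le> cmod (f 0) + cmod (deriv f 0) + B"
    by (simp add: B1_norm_def field_simps)
qed

lemma B1_lincomb:
  assumes f: "f \<in> B1" and g: "g \<in> B1"
  shows "(\<lambda>w. a * f w + b * g w) \<in> B1"
    "B1_norm (\<lambda>w. a * f w + b * g w) \<le> cmod a * B1_norm f + cmod b * B1_norm g"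
proof -
  let ?h = "\<lambda>w. a * f w + b * g w"
  have fh: "f holomorphic_on disc" and gh: "g holomorphic_on disc" using f g by (auto simp: B1_def)
  have hh: "?h holomorphic_on disc" by (intro holomorphic_intros fh gh)
  have d: "cmod (deriv (deriv ?h) z) \<le> cmod a * cmod (deriv (deriv f) z) + cmod b * cmod (deriv (deriv g) z)" if "z \<in> disc" for z
    using higher_deriv_lincomb_disc[OF fh gh that, of 2 a b] norm_triangle_ineq[of "a * deriv (deriv f) z" "b * deriv (deriv g) z"]
    by (simp add: numeral_2_eq_2 norm_mult)
  have "deriv (deriv ?h) holomorphic_on disc" by (intro holomorphic_deriv_disc hh)
  then have m: "(\<lambda>z. indicator disc z *\<^sub>R cmod (deriv (deriv ?h) z)) \<in> borel_measurable borel"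
    by (intro borel_measurable_continuous_on_indicator continuous_intros holomorphic_on_imp_continuous_on) auto
  have fi: "set_integrable lborel disc (\<lambda>z. cmod a * cmod (deriv (deriv f) z))"
    and gi: "set_integrable lborel disc (\<lambda>z. cmod b * cmod (deriv (deriv g) z))"
    using f g by (auto simp: B1_def)
  have si: "set_integrable lborel disc (\<lambda>z. cmod a * cmod (deriv (deriv f) z) + cmod b * cmod (deriv (deriv g) z))"
    by (rule set_integral_add(1)[OF fi gi])
  have hi: "set_integrable lborel disc (\<lambda>z. cmod (deriv (deriv ?h) z))"
    unfolding set_integrable_def
    by (rule Bochner_Integration.integrable_bound[OF si[unfolded set_integrable_def]]) (use m d in \<open>auto simp: indicator_def\<close>)
  show "?h \<in> B1" using hh hi by (simp add: B1_def)
  have "(LINT z : disc | lborel. cmod (deriv (deriv ?h) z))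
     \<le> (LINT z : disc | lborel. cmod a * cmod (deriv (deriv f) z) + cmod b * cmod (deriv (deriv g) z))"
    by (intro set_integral_mono hi si d)
  also have "\<dots> = cmod a * (LINT z : disc | lborel. cmod (deriv (deriv f) z)) + cmod b * (LINT z : disc | lborel. cmod (deriv (deriv g) z))"
    by (subst set_integral_add(2)[OF fi gi]) simp
  finally have I: "(LINT z : disc | lborel. cmod (deriv (deriv ?h) z))
     \<le> cmod a * (LINT z : disc | lborel. cmod (deriv (deriv f) z)) + cmod b * (LINT z : disc | lborel. cmod (deriv (deriv g) z))" .
  have 0: "cmod (a * f 0 + b * g 0) \<le> cmod a * cmod (f 0) + cmod b * cmod (g 0)"
    using norm_triangle_ineq[of "a * f 0" "b * g 0"] by (simp add: norm_mult)
  have 1: "cmod (deriv ?h 0) \<le> cmod a * cmod (deriv f 0) + cmod b * cmod (deriv g 0)"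
    using norm_triangle_ineq[of "a * deriv f 0" "b * deriv g 0"] deriv_lincomb_disc[OF fh gh, of 0 a b] by (simp add: norm_mult)
  have "1 / pi * (LINT z : disc | lborel. cmod (deriv (deriv ?h) z))
     \<le> 1 / pi * (cmod a * (LINT z : disc | lborel. cmod (deriv (deriv f) z)) + cmod b * (LINT z : disc | lborel. cmod (deriv (deriv g) z)))"
    using I by (intro mult_left_mono) auto
  also have "\<dots> = cmod a * (1 / pi * (LINT z : disc | lborel. cmod (deriv (deriv f) z))) + cmod b * (1 / pi * (LINT z : disc | lborel. cmod (deriv (deriv g) z)))"
    by (simp only: distrib_left mult.left_commute)
  finally show "B1_norm ?h \<le> cmod a * B1_norm f + cmod b * B1_norm g"
    unfolding B1_norm_def distrib_left using 0 1 by linarith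
qed

section \<open>The kernels 1 / (1 - cnj a * z) and the norms of the test functions\<close>

lemma one_minus_cnj_mult:
  assumes "cmod a < 1" "z \<in> disc"
  shows "1 - cnj a * z \<noteq> 0" "1 - cmod a \<le> cmod (1 - cnj a * z)" "1 - cmod z \<le> cmod (1 - cnj a * z)"
proof -
  have "cmod (cnj a * z) \<le> cmod a" "cmod (cnj a * z) \<le> cmod z"
    using assms by (auto simp: norm_mult mult_left_le mult_left_le_one_le)
  moreover have "1 - cmod (cnj a * z) \<le> cmod (1 - cnj a * z)"
    using norm_triangle_ineq2[of 1 "cnj a * z"] by simp
  ultimately show 1: "1 - cmod a \<le> cmod (1 - cnj a * z)" "1 - cmod z \<le> cmod (1 - cnj a * z)" by linarith+
  show "1 - cnj a * z \<noteq> 0" using 1 assms by auto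
qed

text \<open>Each differentiation contributes a factor (j + n) cnj a / (1 - cnj a * z), hence the
  rising factorial j (j + 1) ... (j + n - 1). At z = a the powers of 1 - |a|^2 collapse and only
  this factorial times (cnj a / (1 - |a|^2))^n survives.\<close>

lemma higher_deriv_test_fn:
  assumes a: "cmod a < 1" and z: "z \<in> disc"
  shows "(deriv ^^ n) (test_fn j a) z
    = pochhammer (of_nat j) n * cnj a ^ n * of_real (1 - (cmod a)\<^sup>2) ^ j / (1 - cnj a * z) ^ (j + n)"
  using z
proof (induction n arbitrary: z)
  case 0
  then show ?case by (simp add: test_fn_def power_divide)
next
  case (Suc n)
  have nz: "1 - cnj a * z \<noteq> 0" using one_minus_cnj_mult(1)[OF a Suc.prems] .
  have "(deriv ^^ Suc n) (test_fn j a) z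
    = deriv (\<lambda>z. pochhammer (of_nat j) n * cnj a ^ n * of_real (1 - (cmod a)\<^sup>2) ^ j / (1 - cnj a * z) ^ (j + n)) z"
    using deriv_eq_on_disc[OF Suc.IH Suc.prems] by simp
  also have "\<dots> = pochhammer (of_nat j) (Suc n) * cnj a ^ Suc n * of_real (1 - (cmod a)\<^sup>2) ^ j / (1 - cnj a * z) ^ (j + Suc n)"
  proof (rule DERIV_imp_deriv)
    have *: "((\<lambda>z. 1 / (1 - cnj a * z) ^ m) has_field_derivative of_nat m * cnj a / (1 - cnj a * z) ^ Suc m) (at z)" for m
    proof (cases m)
      case (Suc k)
      have "((\<lambda>z. inverse (1 - cnj a * z)) has_field_derivative cnj a * inverse (1 - cnj a * z) ^ 2) (at z)"
        using nz by (auto intro!: derivative_eq_intros simp: power2_eq_square)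
      from DERIV_power[OF this, of m]
      have "((\<lambda>z. inverse (1 - cnj a * z) ^ m) has_field_derivative
          of_nat m * (cnj a * inverse (1 - cnj a * z) ^ 2 * inverse (1 - cnj a * z) ^ k)) (at z)"
        by (simp add: Suc)
      moreover have "of_nat m * (cnj a * inverse (1 - cnj a * z) ^ 2 * inverse (1 - cnj a * z) ^ k)
          = of_nat m * cnj a / (1 - cnj a * z) ^ Suc m"
        unfolding divide_inverse power_inverse[symmetric] Suc
        by (simp add: power2_eq_square mult.assoc del: power_inverse)
      ultimately show ?thesis by (simp only: divide_inverse power_inverse mult_1)
    qed simp
    show "((\<lambda>z. pochhammer (of_nat j) n * cnj a ^ n * of_real (1 - (cmod a)\<^sup>2) ^ j / (1 - cnj a * z) ^ (j + n)) has_field_derivative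
      pochhammer (of_nat j) (Suc n) * cnj a ^ Suc n * of_real (1 - (cmod a)\<^sup>2) ^ j / (1 - cnj a * z) ^ (j + Suc n)) (at z)"
      using DERIV_cmult[OF *[of "j + n"], of "pochhammer (of_nat j) n * cnj a ^ n * of_real (1 - (cmod a)\<^sup>2) ^ j"]
      by (simp add: pochhammer_Suc mult_ac)
  qed
  finally show ?case .
qed

lemma test_fn_holo: "cmod a < 1 \<Longrightarrow> test_fn j a holomorphic_on disc"
  unfolding test_fn_def using one_minus_cnj_mult(1) by (intro holomorphic_intros) auto

text \<open>\<open>k\<close> is the predecessor of the least exponent whose power exceeds
  \<open>M / d\<close>; that exponent is positive because \<open>d \<le> M\<close>.\<close>

lemma dyadic_index:
  fixes d M :: real
  assumes "0 < d" "d \<le> M"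
  obtains k :: nat where "2 ^ k * d \<le> M" "M < 2 ^ Suc k * d"
proof -
  obtain n :: nat where "M / d < 2 ^ n" using real_arch_pow[of 2 "M / d"] by auto
  then have n: "M < 2 ^ n * d" using assms by (simp add: field_simps)
  have n0: "\<not> M < 2 ^ 0 * d" using assms by simp
  obtain k where "k \<le> n" "\<forall>i<k. \<not> M < 2 ^ i * d" "M < 2 ^ k * d"
    using ex_least_nat_le[of "\<lambda>n. M < 2 ^ n * d", OF n] by blast
  moreover from this n0 obtain k' where "k = Suc k'" by (cases k) auto
  ultimately show ?thesis using that[of k'] by (auto simp: not_less)
qed

text \<open>The annuli \<open>2\<^sup>k * d \<le> |1 - cnj a * z| < 2\<^sup>k\<^sup>+\<^sup>1 * d\<close>, where \<open>d = 1 - |a|\<close>, contribute a geometric series.\<close>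

lemma nn_integral_cubic_kernel:
  assumes a: "cmod a < 1"
  shows "(\<integral>\<^sup>+z. ennreal ((1 - cmod a) * (cmod a)\<^sup>2 / cmod (1 - cnj a * z) ^ 3) * indicator disc z \<partial>lborel) \<le> ennreal (8 * pi)"
proof (cases "a = 0")
  case False
  define d where "d = 1 - cmod a"
  have d: "d > 0" using a by (simp add: d_def)
  \<comment> \<open>|1 - cnj a * z| = |a| |c - z|, so each annulus lies in a disc around
    \<open>c\<close>. The area of that disc carries 1 / |a|^2, which the factor |a|^2 of the
    integrand compensates; the bound is therefore uniform as a tends to 0.\<close>
  define c where "c = inverse (cnj a)"
  define F where "F = (\<lambda>k z. ennreal (d * (cmod a)\<^sup>2 / (2 ^ k * d) ^ 3) * indicator (ball c (2 ^ Suc k * d / cmod a)) z)"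
  have "(\<integral>\<^sup>+z. ennreal ((1 - cmod a) * (cmod a)\<^sup>2 / cmod (1 - cnj a * z) ^ 3) * indicator disc z \<partial>lborel)
     \<le> (\<integral>\<^sup>+z. (\<Sum>k. F k z) \<partial>lborel)"
  proof (rule nn_integral_mono)
    fix z
    show "ennreal ((1 - cmod a) * (cmod a)\<^sup>2 / cmod (1 - cnj a * z) ^ 3) * indicator disc z \<le> (\<Sum>k. F k z)"
    proof (cases "z \<in> disc")
      case True
      obtain k where k: "2 ^ k * d \<le> cmod (1 - cnj a * z)" "cmod (1 - cnj a * z) < 2 ^ Suc k * d"
        using dyadic_index[OF d, of "cmod (1 - cnj a * z)"] one_minus_cnj_mult(2)[OF a True] unfolding d_def by blast
      have "1 - cnj a * z = cnj a * (c - z)" using False by (simp add: c_def algebra_simps)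
      then have "cmod (1 - cnj a * z) = cmod a * dist c z" by (simp add: norm_mult dist_norm)
      then have "dist c z < 2 ^ Suc k * d / cmod a" using k(2) False by (simp add: field_simps)
      then have zb: "z \<in> ball c (2 ^ Suc k * d / cmod a)" by simp
      have "(1 - cmod a) * (cmod a)\<^sup>2 / cmod (1 - cnj a * z) ^ 3 \<le> d * (cmod a)\<^sup>2 / (2 ^ k * d) ^ 3"
        unfolding d_def[symmetric] using k d one_minus_cnj_mult(1)[OF a True]
        by (intro divide_left_mono power_mono mult_pos_pos) auto
      then have "ennreal ((1 - cmod a) * (cmod a)\<^sup>2 / cmod (1 - cnj a * z) ^ 3) * indicator disc z \<le> F k z"
        using zb True by (auto simp: F_def indicator_def intro!: ennreal_leI)
      also have "\<dots> \<le> (\<Sum>k. F k z)"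
        using sum_le_suminf[of "\<lambda>k. F k z" "{k}"] by simp
      finally show ?thesis .
    qed auto
  qed
  also have "\<dots> = (\<Sum>k. \<integral>\<^sup>+z. F k z \<partial>lborel)"
    unfolding F_def by (intro nn_integral_suminf borel_measurable_times_ennreal borel_measurable_indicator) auto
  also have "(\<lambda>k. \<integral>\<^sup>+z. F k z \<partial>lborel) = (\<lambda>k. ennreal (4 * pi * (1 / 2) ^ k))"
  proof
    fix k :: nat
    have "(\<integral>\<^sup>+z. F k z \<partial>lborel) = ennreal (d * (cmod a)\<^sup>2 / (2 ^ k * d) ^ 3) * ennreal (pi * (2 ^ Suc k * d / cmod a)\<^sup>2)"
      unfolding F_def using d False
      by (simp add: nn_integral_cmult_indicator emeasure_ball eval_unit_ball_vol ennreal_mult)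
    also have "\<dots> = ennreal (d * (cmod a)\<^sup>2 / (2 ^ k * d) ^ 3 * (pi * (2 ^ Suc k * d / cmod a)\<^sup>2))"
      using d by (intro ennreal_mult[symmetric]) auto
    also have "d * (cmod a)\<^sup>2 / (2 ^ k * d) ^ 3 * (pi * (2 ^ Suc k * d / cmod a)\<^sup>2) = 4 * pi * (1 / 2) ^ k"
      using d False by (simp add: field_simps power2_eq_square power3_eq_cube)
    finally show "(\<integral>\<^sup>+z. F k z \<partial>lborel) = ennreal (4 * pi * (1 / 2) ^ k)" .
  qed
  also have "(\<Sum>k. ennreal (4 * pi * (1 / 2) ^ k)) = ennreal (8 * pi)"
  proof (rule suminf_ennreal_eq)
    show "(\<lambda>k. 4 * pi * (1 / 2) ^ k) sums (8 * pi)"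
      using sums_mult[OF geometric_sums[of "1 / 2 :: real"], of "4 * pi"] by simp
  qed simp
  finally show ?thesis .
qed simp

text \<open>From 1 - |a|^2 <= 2 (1 - |a|) <= 2 |1 - cnj a * z|, all but one factor 1 - |a|^2 can be
  traded against the denominator, which reduces every \<open>j\<close> to the cubic kernel. The
  constants are j (j + 1) 2^j <= 320 and 320 * 8 = 2560; the values at the origin add at most 1 + 4,
  and 3000 is a round bound.\<close>

lemma test_fn_B1:
  assumes a: "cmod a < 1" and j: "j \<in> {1..4}"
  shows "test_fn j a \<in> B1" "B1_norm (test_fn j a) \<le> 3000"
proof -
  define D where "D = 1 - (cmod a)\<^sup>2"
  define d where "d = 1 - cmod a"
  have d: "d > 0" using a by (simp add: d_def)
  have D: "0 < D" "D \<le> 1" "D \<le> 2 * d"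
  proof -
    have "D = (1 - cmod a) * (1 + cmod a)" by (simp add: D_def power2_eq_square algebra_simps)
    moreover have "(1 - cmod a) * (1 + cmod a) \<le> (1 - cmod a) * 2" using a by (intro mult_left_mono) auto
    ultimately show "D \<le> 2 * d" by (simp add: d_def)
    show "0 < D" using a by (simp add: D_def power_less_one_iff abs_square_less_1)
  qed (simp add: D_def)
  have jle: "real j * (real j + 1) * 2 ^ j \<le> 320"
  proof -
    have "real j * (real j + 1) * 2 ^ j \<le> 4 * (4 + 1) * 2 ^ 4"
      using j by (intro mult_mono power_increasing) auto
    then show ?thesis by simp
  qed
  have d2: "cmod (deriv (deriv (test_fn j a)) z) \<le> 320 * (d * (cmod a)\<^sup>2 / cmod (1 - cnj a * z) ^ 3)" if z: "z \<in> disc" for z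
  proof -
    define M where "M = cmod (1 - cnj a * z)"
    have M: "M \<ge> d" "M > 0" using one_minus_cnj_mult[OF a z] d by (auto simp: M_def d_def)
    obtain i where i: "j = Suc i" using j by (cases j) auto
    have eq: "deriv (deriv (test_fn j a)) z = of_nat j * (of_nat j + 1) * cnj a ^ 2 * of_real D ^ j / (1 - cnj a * z) ^ (j + 2)"
      using higher_deriv_test_fn[OF a z, of 2 j] by (simp add: numeral_2_eq_2 pochhammer_Suc D_def)
    have n1: "cmod (of_nat j * (of_nat j + 1)) = real j * (real j + 1)"
      by (metis norm_of_nat of_nat_Suc of_nat_mult add.commute)
    have "cmod (deriv (deriv (test_fn j a)) z) = real j * (real j + 1) * (cmod a)\<^sup>2 * D ^ j / M ^ (j + 2)"
      unfolding eq M_def using D n1 by (simp add: norm_mult norm_divide norm_power del: of_real_power)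
    also have "D ^ j / M ^ (j + 2) \<le> 2 ^ j * d / M ^ 3"
    proof -
      have "D ^ i \<le> (2 * M) ^ i" using D M by (intro power_mono) auto
      moreover have "D ^ j = D ^ i * D" using i by simp
      moreover have "(D ^ i) * D \<le> (2 * M) ^ i * (2 * d)" using calculation(1) D M by (intro mult_mono) auto
      ultimately have "D ^ j \<le> 2 ^ j * M ^ i * d" by (simp add: i power_mult_distrib mult_ac)
      then have "D ^ j / M ^ (j + 2) \<le> 2 ^ j * M ^ i * d / M ^ (j + 2)" using M by (intro divide_right_mono) auto
      also have "\<dots> = 2 ^ j * d / M ^ 3" using M by (simp add: i field_simps power_add power3_eq_cube)
      finally show ?thesis .
    qed
    then have "real j * (real j + 1) * (cmod a)\<^sup>2 * D ^ j / M ^ (j + 2) \<le> real j * (real j + 1) * (cmod a)\<^sup>2 * (2 ^ j * d / M ^ 3)"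
      by (metis (no_types, lifting) mult_left_mono times_divide_eq_right mult_nonneg_nonneg of_nat_0_le_iff zero_le_power2 add_nonneg_nonneg zero_le_one)
    also have "\<dots> = (real j * (real j + 1) * 2 ^ j) * (d * (cmod a)\<^sup>2 / M ^ 3)" by simp
    also have "\<dots> \<le> 320 * (d * (cmod a)\<^sup>2 / M ^ 3)" using jle d M by (intro mult_right_mono) auto
    finally show ?thesis by (simp add: M_def)
  qed
  \<comment> \<open>This bound blows up as |a| tends to 1 and only shows membership; the uniform
    norm bound needs the integral.\<close>
  have bd: "cmod (deriv (deriv (test_fn j a)) z) \<le> 320 * (d * (cmod a)\<^sup>2 / d ^ 3)" if z: "z \<in> disc" for z
  proof (rule order_trans[OF d2[OF z]])
    show "320 * (d * (cmod a)\<^sup>2 / cmod (1 - cnj a * z) ^ 3) \<le> 320 * (d * (cmod a)\<^sup>2 / d ^ 3)"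
      using one_minus_cnj_mult[OF a z] d
      by (intro mult_left_mono divide_left_mono power_mono mult_pos_pos) (auto simp: d_def)
  qed
  have [measurable]: "disc \<in> sets borel" by simp
  show B: "test_fn j a \<in> B1" by (rule B1_of_bounded_deriv2(1)[OF test_fn_holo[OF a] bd])
  have "ennreal (LINT z : disc | lborel. cmod (deriv (deriv (test_fn j a)) z))
     = (\<integral>\<^sup>+z. ennreal (indicator disc z *\<^sub>R cmod (deriv (deriv (test_fn j a)) z)) \<partial>lborel)"
    unfolding set_lebesgue_integral_def
    by (rule nn_integral_eq_integral[symmetric]) (use B in \<open>auto simp: B1_def set_integrable_def\<close>)
  also have "\<dots> \<le> (\<integral>\<^sup>+z. ennreal 320 * (ennreal ((1 - cmod a) * (cmod a)\<^sup>2 / cmod (1 - cnj a * z) ^ 3) * indicator disc z) \<partial>lborel)"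
  proof (rule nn_integral_mono)
    fix z
    show "ennreal (indicator disc z *\<^sub>R cmod (deriv (deriv (test_fn j a)) z))
      \<le> ennreal 320 * (ennreal ((1 - cmod a) * (cmod a)\<^sup>2 / cmod (1 - cnj a * z) ^ 3) * indicator disc z)"
    proof (cases "z \<in> disc")
      case True
      have "ennreal (cmod (deriv (deriv (test_fn j a)) z)) \<le> ennreal (320 * (d * (cmod a)\<^sup>2 / cmod (1 - cnj a * z) ^ 3))"
        by (rule ennreal_leI[OF d2[OF True]])
      also have "\<dots> = ennreal 320 * ennreal (d * (cmod a)\<^sup>2 / cmod (1 - cnj a * z) ^ 3)"
        using d by (intro ennreal_mult) auto
      finally show ?thesis using True by (simp add: d_def)
    qed simp
  qed
  also have "\<dots> = ennreal 320 * (\<integral>\<^sup>+z. ennreal ((1 - cmod a) * (cmod a)\<^sup>2 / cmod (1 - cnj a * z) ^ 3) * indicator disc z \<partial>lborel)"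
    by (rule nn_integral_cmult) measurable
  also have "\<dots> \<le> ennreal 320 * ennreal (8 * pi)"
    by (intro mult_left_mono nn_integral_cubic_kernel a) auto
  also have "\<dots> = ennreal (2560 * pi)" by (subst ennreal_mult[symmetric]) auto
  finally have I: "(LINT z : disc | lborel. cmod (deriv (deriv (test_fn j a)) z)) \<le> 2560 * pi"
    by (simp add: ennreal_le_iff)
  have f0: "cmod (test_fn j a 0) \<le> 1"
    using D by (simp add: test_fn_def D_def[symmetric] norm_power power_le_one del: of_real_power of_real_diff)
  have "deriv (test_fn j a) 0 = of_nat j * cnj a * of_real D ^ j"
    using higher_deriv_test_fn[OF a, of 0 1 j] by (simp add: D_def)
  then have "cmod (deriv (test_fn j a) 0) = real j * (cmod a * D ^ j)"
    using D by (simp add: norm_mult norm_power)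
  also have "\<dots> \<le> real j * (1 * 1)"
    using a D by (intro mult_left_mono mult_mono power_le_one) auto
  also have "\<dots> \<le> 4" using j by simp
  finally have f1: "cmod (deriv (test_fn j a) 0) \<le> 4" .
  have "1 / pi * (LINT z : disc | lborel. cmod (deriv (deriv (test_fn j a)) z)) \<le> 1 / pi * (2560 * pi)"
    using I by (intro mult_left_mono) auto
  with f0 f1 show "B1_norm (test_fn j a) \<le> 3000" unfolding B1_norm_def by simp
qed

section \<open>The weighted operator and its jets\<close>

lemma disc_DERIV: "f holomorphic_on disc \<Longrightarrow> z \<in> disc \<Longrightarrow> (f has_field_derivative deriv f z) (at z)"
  by (rule holomorphic_derivI) auto

text \<open>The contribution of one point \<open>z\<close>: the norm is the supremum of these over
  the disc. Working with it allows limits to be taken at a fixed \<open>z\<close> before any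
  supremum.\<close>

definition Zpart :: "real \<Rightarrow> (complex \<Rightarrow> complex) \<Rightarrow> complex \<Rightarrow> real" where
  "Zpart \<alpha> f z = cmod (f 0) + cmod (deriv f 0) + Zweight \<alpha> f z"

lemma Zweight_nonneg: "Zweight \<alpha> f z \<ge> 0"
  by (simp add: Zweight_def)

lemma Zpart_cong:
  assumes "\<And>z. z \<in> disc \<Longrightarrow> f z = g z" "z \<in> disc"
  shows "Zpart \<alpha> f z = Zpart \<alpha> g z" "Zweight \<alpha> f z = Zweight \<alpha> g z"
proof -
  have d: "deriv f z = deriv g z" if "z \<in> disc" for z
    using deriv_eq_on_disc[OF assms(1) that] .
  have "deriv (deriv f) z = deriv (deriv g) z"
    using deriv_eq_on_disc[OF d assms(2)] .
  then show "Zweight \<alpha> f z = Zweight \<alpha> g z" by (simp add: Zweight_def)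
  then show "Zpart \<alpha> f z = Zpart \<alpha> g z" using assms(1)[of 0] d[of 0] by (simp add: Zpart_def)
qed

text \<open>Linearity of compact operators is only demanded on the disc, so membership and norm must
  ignore the values elsewhere.\<close>

lemma Zspace_cong:
  assumes "\<And>z. z \<in> disc \<Longrightarrow> f z = g z"
  shows "f \<in> Zspace \<alpha> \<longleftrightarrow> g \<in> Zspace \<alpha>" "Z_norm \<alpha> f = Z_norm \<alpha> g"
proof -
  have w: "Zweight \<alpha> f ` disc = Zweight \<alpha> g ` disc"
    using Zpart_cong(2)[OF assms] by (intro image_cong) auto
  have "f holomorphic_on disc \<longleftrightarrow> g holomorphic_on disc"
    using assms by (intro holomorphic_cong) auto
  with w show "f \<in> Zspace \<alpha> \<longleftrightarrow> g \<in> Zspace \<alpha>" by (simp add: Zspace_def)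
  show "Z_norm \<alpha> f = Z_norm \<alpha> g"
    using assms deriv_eq_on_disc[OF assms] w by (simp add: Z_norm_def)
qed

lemma Zspace_holo: "f \<in> Zspace \<alpha> \<Longrightarrow> f holomorphic_on disc"
  by (simp add: Zspace_def)

lemma Zpart_le_Z_norm: "f \<in> Zspace \<alpha> \<Longrightarrow> z \<in> disc \<Longrightarrow> Zpart \<alpha> f z \<le> Z_norm \<alpha> f"
  unfolding Zpart_def Z_norm_def Zspace_def by (intro add_left_mono cSUP_upper) auto

lemma Z_norm_le:
  assumes "\<And>z. z \<in> disc \<Longrightarrow> Zpart \<alpha> f z \<le> B"
  shows "Z_norm \<alpha> f \<le> B"
proof -
  have "(SUP z\<in>disc. Zweight \<alpha> f z) \<le> B - (cmod (f 0) + cmod (deriv f 0))"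
    by (rule cSUP_least) (use assms in \<open>auto simp: Zpart_def algebra_simps\<close>)
  then show ?thesis by (simp add: Z_norm_def)
qed

lemma Z_norm_nonneg: "f \<in> Zspace \<alpha> \<Longrightarrow> Z_norm \<alpha> f \<ge> 0"
  using Zpart_le_Z_norm[of f \<alpha> 0] Zweight_nonneg[of \<alpha> f 0] norm_ge_zero[of "f 0"] norm_ge_zero[of "deriv f 0"]
  unfolding Zpart_def by (smt (verit) centre_in_ball)

lemma Zpart_lincomb:
  assumes f: "f holomorphic_on disc" and g: "g holomorphic_on disc" and z: "z \<in> disc"
  shows "Zpart \<alpha> (\<lambda>w. a * f w + b * g w) z \<le> cmod a * Zpart \<alpha> f z + cmod b * Zpart \<alpha> g z"
    "Zweight \<alpha> (\<lambda>w. a * f w + b * g w) z \<le> cmod a * Zweight \<alpha> f z + cmod b * Zweight \<alpha> g z"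
proof -
  have t: "cmod (a * x + b * y) \<le> cmod a * cmod x + cmod b * cmod y" for x y
    using norm_triangle_ineq[of "a * x" "b * y"] by (simp add: norm_mult)
  have d2: "deriv (deriv (\<lambda>w. a * f w + b * g w)) z = a * deriv (deriv f) z + b * deriv (deriv g) z"
    using higher_deriv_lincomb_disc[OF f g z, of 2 a b] by (simp add: numeral_2_eq_2)
  have "Zweight \<alpha> (\<lambda>w. a * f w + b * g w) z
      \<le> (1 - (cmod z)\<^sup>2) powr \<alpha> * (cmod a * cmod (deriv (deriv f) z) + cmod b * cmod (deriv (deriv g) z))"
    unfolding Zweight_def d2 by (intro mult_left_mono t) auto
  then show w: "Zweight \<alpha> (\<lambda>w. a * f w + b * g w) z \<le> cmod a * Zweight \<alpha> f z + cmod b * Zweight \<alpha> g z"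
    by (simp add: Zweight_def algebra_simps)
  have "deriv (\<lambda>w. a * f w + b * g w) 0 = a * deriv f 0 + b * deriv g 0"
    by (rule deriv_lincomb_disc[OF f g]) simp
  with w t[of "f 0" "g 0"] t[of "deriv f 0" "deriv g 0"]
  show "Zpart \<alpha> (\<lambda>w. a * f w + b * g w) z \<le> cmod a * Zpart \<alpha> f z + cmod b * Zpart \<alpha> g z"
    unfolding Zpart_def by (simp add: algebra_simps)
qed

lemma Zspace_lincomb:
  assumes f: "f \<in> Zspace \<alpha>" and g: "g \<in> Zspace \<alpha>"
  shows "(\<lambda>w. a * f w + b * g w) \<in> Zspace \<alpha>"
    "Z_norm \<alpha> (\<lambda>w. a * f w + b * g w) \<le> cmod a * Z_norm \<alpha> f + cmod b * Z_norm \<alpha> g"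
proof -
  have h: "f holomorphic_on disc" "g holomorphic_on disc" using f g by (auto simp: Zspace_def)
  have le: "Zpart \<alpha> (\<lambda>w. a * f w + b * g w) z \<le> cmod a * Z_norm \<alpha> f + cmod b * Z_norm \<alpha> g" if z: "z \<in> disc" for z
    by (rule order_trans[OF Zpart_lincomb(1)[OF h z]])
       (intro add_mono mult_left_mono Zpart_le_Z_norm f g z norm_ge_zero)
  then show "Z_norm \<alpha> (\<lambda>w. a * f w + b * g w) \<le> cmod a * Z_norm \<alpha> f + cmod b * Z_norm \<alpha> g"
    by (rule Z_norm_le)
  have "Zweight \<alpha> (\<lambda>w. a * f w + b * g w) z \<le> cmod a * Z_norm \<alpha> f + cmod b * Z_norm \<alpha> g" if z: "z \<in> disc" for z
    using le[OF z] norm_ge_zero[of "a * f 0 + b * g 0"] norm_ge_zero[of "deriv (\<lambda>w. a * f w + b * g w) 0"]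
    unfolding Zpart_def by linarith
  then have "bdd_above (Zweight \<alpha> (\<lambda>w. a * f w + b * g w) ` disc)" by (rule bdd_aboveI2)
  moreover have "(\<lambda>w. a * f w + b * g w) holomorphic_on disc" by (intro holomorphic_intros h)
  ultimately show "(\<lambda>w. a * f w + b * g w) \<in> Zspace \<alpha>" by (simp add: Zspace_def)
qed

section \<open>3-jets and cubic Taylor polynomials\<close>

definition jet_sum :: "(complex \<Rightarrow> complex) \<Rightarrow> complex \<Rightarrow> real" where
  "jet_sum f w = cmod (f w) + cmod (deriv f w) + cmod (deriv (deriv f) w) + cmod (deriv (deriv (deriv f)) w)"

definition taylor3 :: "(complex \<Rightarrow> complex) \<Rightarrow> complex \<Rightarrow> complex \<Rightarrow> complex" where
  "taylor3 f w = (\<lambda>z. f w + deriv f w * (z - w) + deriv (deriv f) w / 2 * (z - w)\<^sup>2 + deriv (deriv (deriv f)) w / 6 * (z - w)^3)"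

lemma taylor3_derivs:
  "deriv (taylor3 f w) = (\<lambda>z. deriv f w + deriv (deriv f) w * (z - w) + deriv (deriv (deriv f)) w / 2 * (z - w)\<^sup>2)"
  "deriv (deriv (taylor3 f w)) = (\<lambda>z. deriv (deriv f) w + deriv (deriv (deriv f)) w * (z - w))"
  "deriv (deriv (deriv (taylor3 f w))) = (\<lambda>z. deriv (deriv (deriv f)) w)"
proof -
  show 1: "deriv (taylor3 f w) = (\<lambda>z. deriv f w + deriv (deriv f) w * (z - w) + deriv (deriv (deriv f)) w / 2 * (z - w)\<^sup>2)"
    unfolding taylor3_def
    by (intro ext DERIV_imp_deriv) (auto intro!: derivative_eq_intros simp: power2_eq_square field_simps)
  show 2: "deriv (deriv (taylor3 f w)) = (\<lambda>z. deriv (deriv f) w + deriv (deriv (deriv f)) w * (z - w))"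
    unfolding 1 by (intro ext DERIV_imp_deriv) (auto intro!: derivative_eq_intros)
  show "deriv (deriv (deriv (taylor3 f w))) = (\<lambda>z. deriv (deriv (deriv f)) w)"
    unfolding 2 by (intro ext DERIV_imp_deriv) (auto intro!: derivative_eq_intros)
qed

lemma taylor3_jet:
  "taylor3 f w w = f w" "deriv (taylor3 f w) w = deriv f w" "deriv (deriv (taylor3 f w)) w = deriv (deriv f) w"
  "deriv (deriv (deriv (taylor3 f w))) w = deriv (deriv (deriv f)) w"
proof -
  show "taylor3 f w w = f w" by (simp add: taylor3_def)
  show "deriv (taylor3 f w) w = deriv f w" unfolding taylor3_derivs(1) by simp
  show "deriv (deriv (taylor3 f w)) w = deriv (deriv f) w" unfolding taylor3_derivs(2) by simp
  show "deriv (deriv (deriv (taylor3 f w))) w = deriv (deriv (deriv f)) w" unfolding taylor3_derivs(3) by simp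
qed

text \<open>Only the four numbers in the jet matter. With |w| <= 1 and |z - w| <= 2 they enter the
  norm with total weights 1, 2, 5/2 and 8/3, all at most 4.\<close>

lemma taylor3_B1:
  assumes w: "w \<in> disc"
  shows "taylor3 f w \<in> B1" "B1_norm (taylor3 f w) \<le> 4 * jet_sum f w"
proof -
  have wn: "cmod w \<le> 1" using w by simp
  define c0 c1 c2 c3 where "c0 = f w" and "c1 = deriv f w" and "c2 = deriv (deriv f) w" and "c3 = deriv (deriv (deriv f)) w"
  have p: "taylor3 f w = (\<lambda>z. c0 + c1 * (z - w) + c2 / 2 * (z - w)\<^sup>2 + c3 / 6 * (z - w)^3)"
    by (simp add: taylor3_def c0_def c1_def c2_def c3_def)
  have holo: "taylor3 f w holomorphic_on disc" unfolding p by (intro holomorphic_intros)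
  have sh: "cmod (x * w ^ n) \<le> cmod x" for x n
    using wn by (simp add: norm_mult norm_power power_le_one mult_left_le)
  have b2: "cmod (deriv (deriv (taylor3 f w)) z) \<le> cmod c2 + 2 * cmod c3" if z: "z \<in> disc" for z
  proof -
    have "cmod (z - w) \<le> 2" using norm_triangle_ineq4[of z w] z wn by simp
    then have "cmod (c3 * (z - w)) \<le> cmod c3 * 2" by (simp add: norm_mult mult_left_mono)
    then show ?thesis
      using norm_triangle_ineq[of c2 "c3 * (z - w)"] by (simp add: taylor3_derivs(2) c2_def c3_def)
  qed
  show "taylor3 f w \<in> B1" by (rule B1_of_bounded_deriv2(1)[OF holo b2])
  have "taylor3 f w 0 = c0 - c1 * w ^ 1 + c2 / 2 * w ^ 2 - c3 / 6 * w ^ 3"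
    by (simp add: p)
  then have "cmod (taylor3 f w 0) \<le> cmod c0 + cmod (c1 * w ^ 1) + cmod (c2 / 2 * w ^ 2) + cmod (c3 / 6 * w ^ 3)"
    using norm_triangle_ineq4[of "c0 - c1 * w ^ 1 + c2 / 2 * w ^ 2" "c3 / 6 * w ^ 3"]
      norm_triangle_ineq[of "c0 - c1 * w ^ 1" "c2 / 2 * w ^ 2"] norm_triangle_ineq4[of "c0" "c1 * w ^ 1"] by simp
  also have "\<dots> \<le> cmod c0 + cmod c1 + cmod (c2 / 2) + cmod (c3 / 6)"
    by (intro add_mono sh order_refl)
  finally have 0: "cmod (taylor3 f w 0) \<le> cmod c0 + cmod c1 + cmod c2 / 2 + cmod c3 / 6"
    by (simp add: norm_divide)
  have "deriv (taylor3 f w) 0 = c1 - c2 * w ^ 1 + c3 / 2 * w ^ 2"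
    by (simp add: taylor3_derivs(1) c1_def c2_def c3_def)
  then have "cmod (deriv (taylor3 f w) 0) \<le> cmod c1 + cmod (c2 * w ^ 1) + cmod (c3 / 2 * w ^ 2)"
    using norm_triangle_ineq[of "c1 - c2 * w ^ 1" "c3 / 2 * w ^ 2"] norm_triangle_ineq4[of "c1" "c2 * w ^ 1"] by simp
  also have "\<dots> \<le> cmod c1 + cmod c2 + cmod (c3 / 2)"
    by (intro add_mono sh order_refl)
  finally have 1: "cmod (deriv (taylor3 f w) 0) \<le> cmod c1 + cmod c2 + cmod c3 / 2"
    by (simp add: norm_divide)
  show "B1_norm (taylor3 f w) \<le> 4 * jet_sum f w"
  proof -
    have "B1_norm (taylor3 f w) \<le> cmod (taylor3 f w 0) + cmod (deriv (taylor3 f w) 0) + (cmod c2 + 2 * cmod c3)"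
      by (rule B1_of_bounded_deriv2(2)[OF holo b2])
    moreover have "jet_sum f w = cmod c0 + cmod c1 + cmod c2 + cmod c3"
      by (simp add: jet_sum_def c0_def c1_def c2_def c3_def)
    ultimately show ?thesis
      using 0 1 norm_ge_zero[of c0] norm_ge_zero[of c1] norm_ge_zero[of c2] norm_ge_zero[of c3] by linarith
  qed
qed

text \<open>\<open>M\<close> is divided by when r and the tolerances are chosen, hence its
  positivity; it does not enter the constants of the final comparison.\<close>

locale bounded_operator =
  fixes \<alpha> :: real and u v \<phi> :: "complex \<Rightarrow> complex" and M :: real
  assumes u: "u holomorphic_on disc" and v: "v holomorphic_on disc" and \<phi>: "\<phi> holomorphic_on disc"
    and \<phi>_disc: "\<And>z. z \<in> disc \<Longrightarrow> \<phi> z \<in> disc"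
    and T_Zspace: "\<And>f. f \<in> B1 \<Longrightarrow> Tuvphi u v \<phi> f \<in> Zspace \<alpha>"
    and T_bound: "\<And>f. f \<in> B1 \<Longrightarrow> Z_norm \<alpha> (Tuvphi u v \<phi> f) \<le> M * B1_norm f"
    and M_pos: "M > 0"
begin

abbreviation "T \<equiv> Tuvphi u v \<phi>"

lemma deriv_T:
  assumes f: "f holomorphic_on disc" and z: "z \<in> disc"
  shows "deriv (T f) z = deriv u z * f (\<phi> z) + (u z * deriv \<phi> z + deriv v z) * deriv f (\<phi> z)
      + v z * deriv \<phi> z * deriv (deriv f) (\<phi> z)"
proof (rule DERIV_imp_deriv)
  note d = disc_DERIV[OF u z] disc_DERIV[OF v z]
    DERIV_chain2[where g = \<phi>, OF disc_DERIV[OF f \<phi>_disc[OF z]] disc_DERIV[OF \<phi> z]]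
    DERIV_chain2[where g = \<phi>, OF disc_DERIV[OF holomorphic_deriv_disc[OF f] \<phi>_disc[OF z]] disc_DERIV[OF \<phi> z]]
  show "(T f has_field_derivative deriv u z * f (\<phi> z) + (u z * deriv \<phi> z + deriv v z) * deriv f (\<phi> z)
      + v z * deriv \<phi> z * deriv (deriv f) (\<phi> z)) (at z)"
    unfolding Tuvphi_def
    by (rule DERIV_cong[OF DERIV_add[OF DERIV_mult[OF d(1) d(3)] DERIV_mult[OF d(2) d(4)]]])
       (simp add: algebra_simps)
qed

lemma deriv2_T:
  assumes f: "f holomorphic_on disc" and z: "z \<in> disc"
  shows "deriv (deriv (T f)) z = deriv (deriv u) z * f (\<phi> z)
      + (2 * deriv u z * deriv \<phi> z + u z * deriv (deriv \<phi>) z + deriv (deriv v) z) * deriv f (\<phi> z)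
      + (u z * (deriv \<phi> z)\<^sup>2 + 2 * deriv v z * deriv \<phi> z + v z * deriv (deriv \<phi>) z) * deriv (deriv f) (\<phi> z)
      + v z * (deriv \<phi> z)\<^sup>2 * deriv (deriv (deriv f)) (\<phi> z)" (is "_ = ?R")
proof -
  have f1: "deriv f holomorphic_on disc" and f2: "deriv (deriv f) holomorphic_on disc"
    by (intro holomorphic_deriv_disc f)+
  have u1: "deriv u holomorphic_on disc" and v1: "deriv v holomorphic_on disc" and p1: "deriv \<phi> holomorphic_on disc"
    by (intro holomorphic_deriv_disc u v \<phi>)+
  note du = disc_DERIV[OF u z] and dv = disc_DERIV[OF v z] and du1 = disc_DERIV[OF u1 z]
    and dv1 = disc_DERIV[OF v1 z] and dp = disc_DERIV[OF \<phi> z] and dp1 = disc_DERIV[OF p1 z]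
    and df = DERIV_chain2[where g = \<phi>, OF disc_DERIV[OF f \<phi>_disc[OF z]] disc_DERIV[OF \<phi> z]]
    and df1 = DERIV_chain2[where g = \<phi>, OF disc_DERIV[OF f1 \<phi>_disc[OF z]] disc_DERIV[OF \<phi> z]]
    and df2 = DERIV_chain2[where g = \<phi>, OF disc_DERIV[OF f2 \<phi>_disc[OF z]] disc_DERIV[OF \<phi> z]]
  have "deriv (deriv (T f)) z = deriv (\<lambda>z. deriv u z * f (\<phi> z) + (u z * deriv \<phi> z + deriv v z) * deriv f (\<phi> z)
      + v z * deriv \<phi> z * deriv (deriv f) (\<phi> z)) z"
    by (rule deriv_eq_on_disc[OF deriv_T[OF f] z])
  also have "\<dots> = ?R"
    by (rule DERIV_imp_deriv, rule DERIV_cong[OF DERIV_add[OF DERIV_add[OF DERIV_mult[OF du1 df]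
          DERIV_mult[OF DERIV_add[OF DERIV_mult[OF du dp1] dv1] df1]] DERIV_mult[OF DERIV_mult[OF dv dp1] df2]]])
       (simp add: algebra_simps power2_eq_square)
  finally show ?thesis .
qed

lemma T_lincomb:
  assumes "f holomorphic_on disc" "g holomorphic_on disc" "z \<in> disc"
  shows "T (\<lambda>w. a * f w + b * g w) z = a * T f z + b * T g z"
  using deriv_lincomb_disc[OF assms(1,2) \<phi>_disc[OF assms(3)], of a b]
  by (simp add: Tuvphi_def algebra_simps)

text \<open>\<open>T f\<close> at \<open>z\<close> sees only the 3-jet of \<open>f\<close> at \<open>\<phi> z\<close>, so \<open>f\<close> may be replaced by a cubic polynomial,
  to which the boundedness of \<open>T\<close> applies.\<close>

lemma Zweight_T_jet:
  assumes k: "k holomorphic_on disc" and z: "z \<in> disc"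
  shows "Zweight \<alpha> (T k) z \<le> 4 * M * jet_sum k (\<phi> z)"
proof -
  define p where "p = taylor3 k (\<phi> z)"
  have p: "p \<in> B1" "B1_norm p \<le> 4 * jet_sum k (\<phi> z)" using taylor3_B1[OF \<phi>_disc[OF z]] by (simp_all add: p_def)
  have "deriv (deriv (T k)) z = deriv (deriv (T p)) z"
    using k p(1) z by (simp add: deriv2_T B1_holo) (simp add: p_def taylor3_jet)
  then have "Zweight \<alpha> (T k) z = Zweight \<alpha> (T p) z" by (simp add: Zweight_def)
  also have "\<dots> \<le> Zpart \<alpha> (T p) z" by (simp add: Zpart_def)
  also have "\<dots> \<le> Z_norm \<alpha> (T p)" by (rule Zpart_le_Z_norm[OF T_Zspace[OF p(1)] z])
  also have "\<dots> \<le> M * B1_norm p" by (rule T_bound[OF p(1)])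
  also have "\<dots> \<le> M * (4 * jet_sum k (\<phi> z))" using M_pos p(2) by (intro mult_left_mono) auto
  finally show ?thesis by simp
qed

text \<open>The two origin terms of the norm see the jet at \<open>\<phi> 0\<close>. For this reason
  the level separating small from large |\<phi>| will have to lie above |\<phi> 0|.\<close>

lemma T_origin_jet:
  assumes k: "k holomorphic_on disc"
  shows "cmod (T k 0) + cmod (deriv (T k) 0) \<le> 4 * M * jet_sum k (\<phi> 0)"
proof -
  define p where "p = taylor3 k (\<phi> 0)"
  have p: "p \<in> B1" "B1_norm p \<le> 4 * jet_sum k (\<phi> 0)" using taylor3_B1[OF \<phi>_disc[of 0]] by (simp_all add: p_def)
  have "deriv (T k) 0 = deriv (T p) 0"
    using k p(1) by (simp add: deriv_T B1_holo) (simp add: p_def taylor3_jet)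
  moreover have "T k 0 = T p 0" by (simp add: Tuvphi_def p_def taylor3_jet)
  ultimately have "cmod (T k 0) + cmod (deriv (T k) 0) = cmod (T p 0) + cmod (deriv (T p) 0)" by simp
  also have "\<dots> \<le> Zpart \<alpha> (T p) 0" by (simp add: Zpart_def Zweight_nonneg)
  also have "\<dots> \<le> Z_norm \<alpha> (T p)" by (rule Zpart_le_Z_norm[OF T_Zspace[OF p(1)]]) simp
  also have "\<dots> \<le> M * B1_norm p" by (rule T_bound[OF p(1)])
  also have "\<dots> \<le> M * (4 * jet_sum k (\<phi> 0))" using M_pos p(2) by (intro mult_left_mono) auto
  finally show ?thesis by simp
qed

end

section \<open>Dilations\<close>

definition dil :: "real \<Rightarrow> (complex \<Rightarrow> complex) \<Rightarrow> complex \<Rightarrow> complex" where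
  "dil r f = (\<lambda>w. f (of_real r * w))"

lemma dil_mem_disc:
  assumes "0 < r" "r < 1" "w \<in> disc"
  shows "of_real r * w \<in> disc" "cmod (of_real r * w) \<le> cmod w" "cmod (of_real r * w) \<le> r"
  using assms by (auto simp: norm_mult mult_left_le mult_left_le_one_le intro: le_less_trans[of _ r])

lemma dil_holo:
  assumes "0 < r" "r < 1" "f holomorphic_on disc"
  shows "dil r f holomorphic_on disc"
  unfolding dil_def
  by (intro holomorphic_on_compose_gen[OF _ assms(3), unfolded o_def] holomorphic_intros)
     (use dil_mem_disc(1)[OF assms(1,2)] in auto)

lemma higher_deriv_dil:
  assumes "0 < r" "r < 1" "f holomorphic_on disc" "w \<in> disc"
  shows "(deriv ^^ n) (dil r f) w = of_real r ^ n * (deriv ^^ n) f (of_real r * w)"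
  unfolding dil_def
  by (rule higher_deriv_compose_linear[where S = disc and T = disc])
     (use assms dil_mem_disc(1)[OF assms(1,2)] in auto)

lemma dil_derivs:
  assumes "0 < r" "r < 1" "f holomorphic_on disc" "w \<in> disc"
  shows "deriv (dil r f) w = of_real r * deriv f (of_real r * w)"
    "deriv (deriv (dil r f)) w = of_real r ^ 2 * deriv (deriv f) (of_real r * w)"
    "deriv (deriv (deriv (dil r f))) w = of_real r ^ 3 * deriv (deriv (deriv f)) (of_real r * w)"
  using higher_deriv_dil[OF assms, of 1] higher_deriv_dil[OF assms, of 2] higher_deriv_dil[OF assms, of 3]
  by (simp_all add: numeral_2_eq_2 numeral_3_eq_3)

text \<open>The dilation samples \<open>f\<close> only on |w| <= r, and discs of radius R - r around
  such points stay where |f| <= B, so Cauchy's inequality applies. Uniform smallness on a compact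
  disc thus becomes smallness in norm after dilation, which is the source of compactness.\<close>

lemma dil_B1_norm:
  assumes r: "0 < r" "r < 1" and R: "r < R" "R < 1" and f: "f holomorphic_on disc"
    and B: "\<And>w. w \<in> cball 0 R \<Longrightarrow> cmod (f w) \<le> B"
  shows "dil r f \<in> B1" "B1_norm (dil r f) \<le> B * (1 + 1 / (R - r) + 2 / (R - r)\<^sup>2)"
proof -
  have C: "cmod ((deriv ^^ n) f w) \<le> fact n * B / (R - r) ^ n" if w: "cmod w \<le> r" for w n
  proof (rule Cauchy_estimate[OF f])
    have sub: "cball w (R - r) \<subseteq> cball 0 R"
      using w norm_triangle_ineq[of w] by (auto simp: dist_norm) (smt (verit) norm_triangle_sub norm_minus_commute)
    then show "cball w (R - r) \<subseteq> disc" using R by auto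
    show "\<And>x. x \<in> cball w (R - r) \<Longrightarrow> cmod (f x) \<le> B" using sub B by blast
  qed (use R in auto)
  have B0: "B \<ge> 0" using order_trans[OF norm_ge_zero B[of 0]] r R by simp
  have d2: "cmod (deriv (deriv (dil r f)) w) \<le> 2 * B / (R - r)\<^sup>2" if w: "w \<in> disc" for w
  proof -
    have "cmod (deriv (deriv (dil r f)) w) \<le> cmod (deriv (deriv f) (of_real r * w))"
      using r by (simp add: dil_derivs(2)[OF r f w] norm_mult norm_power power_le_one mult_left_le_one_le)
    also have "\<dots> \<le> 2 * B / (R - r)\<^sup>2"
      using C[OF dil_mem_disc(3)[OF r w], of 2] by (simp add: numeral_2_eq_2)
    finally show ?thesis .
  qed
  show "dil r f \<in> B1" by (rule B1_of_bounded_deriv2(1)[OF dil_holo[OF r f] d2])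
  have 0: "cmod (dil r f 0) \<le> B" using B[of 0] r R by (simp add: dil_def)
  have "cmod (deriv (dil r f) 0) \<le> cmod (deriv f 0)"
    using r by (simp add: dil_derivs(1)[OF r f] norm_mult mult_left_le_one_le)
  then have 1: "cmod (deriv (dil r f) 0) \<le> B / (R - r)" using C[of 0 1] r by simp
  have "B1_norm (dil r f) \<le> cmod (dil r f 0) + cmod (deriv (dil r f) 0) + 2 * B / (R - r)\<^sup>2"
    by (rule B1_of_bounded_deriv2(2)[OF dil_holo[OF r f] d2])
  with 0 1 show "B1_norm (dil r f) \<le> B * (1 + 1 / (R - r) + 2 / (R - r)\<^sup>2)"
    by (simp add: algebra_simps)
qed

lemma dil_B1:
  assumes r: "0 < r" "r < 1" and f: "f holomorphic_on disc"
  shows "dil r f \<in> B1"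
proof -
  define R where "R = (1 + r) / 2"
  have R: "r < R" "R < 1" using r by (auto simp: R_def)
  have "continuous_on (cball 0 R) f"
    using R by (intro holomorphic_on_imp_continuous_on holomorphic_on_subset[OF f]) auto
  then have "bounded (f ` cball 0 R)" by (intro compact_imp_bounded compact_continuous_image) auto
  then obtain B where "\<forall>y\<in>f ` cball 0 R. cmod y \<le> B" by (metis bounded_iff)
  then show ?thesis by (intro dil_B1_norm(1)[OF r R f]) auto
qed

text \<open>With \<open>\<rho>\<close> as below, |f'| <= 1 / \<rho> on |x| <= 1 - \<rho>, so f(x) -
  f(rx) is at most (1 - r) / \<rho> there. As \<delta> + \<rho> = 1 - \<rho>, Cauchy's inequality
  with radius \<rho> passes this to derivatives of order at most 3; 24 is four terms times 3!. The
  bound is uniform over the unit ball.\<close>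

lemma dil_diff_jet:
  assumes r: "0 < r" "r < 1" and \<delta>: "0 \<le> \<delta>" "\<delta> < 1" and f: "f \<in> B1" "B1_norm f \<le> 1"
    and w: "cmod w \<le> \<delta>"
  shows "jet_sum (\<lambda>w. 1 * f w + (-1) * dil r f w) w \<le> 24 * (1 - r) / ((1 - \<delta>) / 2) ^ 4"
proof -
  define \<rho> where "\<rho> = (1 - \<delta>) / 2"
  define k where "k = (\<lambda>w. 1 * f w + (-1) * dil r f w)"
  have \<rho>: "0 < \<rho>" "\<rho> \<le> 1" using \<delta> by (auto simp: \<rho>_def)
  have fh: "f holomorphic_on disc" by (rule B1_holo[OF f(1)])
  have kh: "k holomorphic_on disc" unfolding k_def by (intro holomorphic_intros fh dil_holo r)
  have kb: "cmod (k x) \<le> (1 - r) / \<rho>" if x: "x \<in> cball 0 (1 - \<rho>)" for x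
  proof -
    have rx: "of_real r * x \<in> cball 0 (1 - \<rho>)"
      using x r mult_left_le_one_le[of "cmod x" r] by (simp add: norm_mult)
    have sub: "cball 0 (1 - \<rho>) \<subseteq> disc" using \<rho> by auto
    have "cmod (f x - f (of_real r * x)) \<le> 1 / \<rho> * cmod (x - of_real r * x)"
    proof (rule field_differentiable_bound[where S = "cball 0 (1 - \<rho>)" and f' = "deriv f"])
      fix z :: complex assume z: "z \<in> cball 0 (1 - \<rho>)"
      then have zd: "z \<in> disc" using sub by blast
      show "(f has_field_derivative deriv f z) (at z within cball 0 (1 - \<rho>))"
        by (rule has_field_derivative_at_within[OF disc_DERIV[OF fh zd]])
      have "cmod (deriv f z) \<le> B1_norm f / (1 - cmod z)" by (rule B1_deriv1_bound[OF f(1) zd])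
      also have "\<dots> \<le> 1 / \<rho>" using z f \<rho> B1_norm_nonneg[of f] by (intro frac_le) auto
      finally show "cmod (deriv f z) \<le> 1 / \<rho>" .
    qed (use x rx in auto)
    also have "cmod (x - of_real r * x) = (1 - r) * cmod x"
    proof -
      have "x - of_real r * x = of_real (1 - r) * x" by (simp add: algebra_simps)
      then show ?thesis using r by (simp only: norm_mult norm_of_real)
    qed
    also have "1 / \<rho> * ((1 - r) * cmod x) \<le> 1 / \<rho> * ((1 - r) * 1)"
      using r \<rho> x by (intro mult_left_mono) auto
    finally show ?thesis by (simp add: k_def dil_def)
  qed
  have C: "cmod ((deriv ^^ n) k w) \<le> 6 * (1 - r) / \<rho> ^ 4" if n: "n \<le> 3" for n
  proof -
    have sub: "cball w \<rho> \<subseteq> cball 0 (1 - \<rho>)"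
    proof
      fix x assume "x \<in> cball w \<rho>"
      then have "cmod (x - w) \<le> \<rho>" by (simp add: dist_norm norm_minus_commute)
      moreover have "\<delta> + \<rho> = 1 - \<rho>" by (simp add: \<rho>_def field_simps)
      ultimately show "x \<in> cball 0 (1 - \<rho>)" using w norm_triangle_sub[of x w] by simp
    qed
    have "cmod ((deriv ^^ n) k w) \<le> fact n * ((1 - r) / \<rho>) / \<rho> ^ n"
      by (rule Cauchy_estimate[OF kh open_ball _ \<rho>(1)]) (use sub \<rho> kb in auto)
    also have "\<dots> \<le> fact 3 * ((1 - r) / \<rho>) / \<rho> ^ 3"
      using n r \<rho> by (intro frac_le mult_right_mono fact_mono power_decreasing mult_nonneg_nonneg) auto
    also have "\<dots> = 6 * (1 - r) / \<rho> ^ 4" using \<rho> by (simp add: fact_numeral field_simps eval_nat_numeral)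
    finally show ?thesis .
  qed
  define q where "q = 6 * (1 - r) / \<rho> ^ 4"
  have "jet_sum k w \<le> 4 * q"
    using C[of 0, folded q_def] C[of 1, folded q_def] C[of 2, folded q_def] C[of 3, folded q_def]
    by (simp add: jet_sum_def numeral_2_eq_2 numeral_3_eq_3)
  also have "4 * q = 24 * (1 - r) / \<rho> ^ 4" by (simp add: q_def)
  finally show ?thesis by (simp only: k_def \<rho>_def)
qed

text \<open>Uniform in \<open>r\<close>, because |rw| <= |w| lets the dilation inherit the bounds of
  \<open>f\<close>. The worst case is order 3: 128 = 2 * 8 * 2^3, with 2 from the difference, 8 from
  the third derivative bound and 2^3 from 1 - |w|^2 <= 2 (1 - |w|).\<close>

lemma dil_diff_growth:
  assumes r: "0 < r" "r < 1" and f: "f \<in> B1" "B1_norm f \<le> 1" and w: "w \<in> disc"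
  defines "k \<equiv> \<lambda>w. 1 * f w + (-1) * dil r f w"
  shows "cmod (k w) \<le> 128" "cmod (deriv k w) \<le> 128 / (1 - (cmod w)\<^sup>2)"
    "cmod (deriv (deriv k) w) \<le> 128 / (1 - (cmod w)\<^sup>2)\<^sup>2"
    "cmod (deriv (deriv (deriv k)) w) \<le> 128 / (1 - (cmod w)\<^sup>2) ^ 3"
proof -
  define s where "s = 1 - cmod w"
  define t where "t = 1 - (cmod w)\<^sup>2"
  have s: "0 < s" "s \<le> 1" using w by (auto simp: s_def)
  have t: "0 < t" "t \<le> 2 * s"
  proof -
    have teq: "t = s * (1 + cmod w)" by (simp add: t_def s_def power2_eq_square algebra_simps)
    then show "0 < t" using s by (simp add: add_pos_nonneg)
    show "t \<le> 2 * s" unfolding teq using mult_left_mono[of "1 + cmod w" 2 s] s w by simp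
  qed
  have fh: "f holomorphic_on disc" by (rule B1_holo[OF f(1)])
  have dh: "dil r f holomorphic_on disc" by (intro dil_holo r fh)
  note rw = dil_mem_disc[OF r w]
  have rs: "s \<le> 1 - cmod (of_real r * w)" using rw(2) by (simp add: s_def)
  have diff: "cmod (1 * x + (-1) * y) \<le> cmod x + cmod y" for x y
    using norm_triangle_ineq4[of x y] by simp
  have N: "0 \<le> B1_norm f" by (rule B1_norm_nonneg)
  have pw: "cmod (of_real r ^ n * x) \<le> cmod x" for n x
    using r by (simp add: norm_mult norm_power power_le_one mult_left_le_one_le)
  have hd: "(deriv ^^ n) k w = 1 * (deriv ^^ n) f w + (-1) * (of_real r ^ n * (deriv ^^ n) f (of_real r * w))" for n
    unfolding k_def by (subst higher_deriv_lincomb_disc[OF fh dh w], subst higher_deriv_dil[OF r fh w]) simp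
  have est: "cmod ((deriv ^^ n) k w) \<le> 2 * X" if "cmod ((deriv ^^ n) f w) \<le> X" "cmod ((deriv ^^ n) f (of_real r * w)) \<le> X" for n X
    unfolding hd using diff[of "(deriv ^^ n) f w" "of_real r ^ n * (deriv ^^ n) f (of_real r * w)"]
      pw[of n "(deriv ^^ n) f (of_real r * w)"] that by linarith
  have fr: "c * B1_norm f / (1 - cmod x) ^ n \<le> c / s ^ n" if "s \<le> 1 - cmod x" "c \<ge> 0" for x n c
    using that s f N by (intro frac_le power_mono) (auto simp: mult_left_le)
  have st: "c / s ^ n \<le> c * 2 ^ n / t ^ n" if "c \<ge> 0" for c n
  proof -
    have "c / s ^ n = c * 2 ^ n / (2 * s) ^ n" by (simp add: power_mult_distrib)
    also have "\<dots> \<le> c * 2 ^ n / t ^ n" using t s that by (intro divide_left_mono power_mono mult_pos_pos) auto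
    finally show ?thesis .
  qed
  have "cmod (k w) \<le> 2 * 9"
    using est[of 0 9] B1_sup_bound[OF f(1) w] B1_sup_bound[OF f(1) rw(1)] f(2) by simp
  then show "cmod (k w) \<le> 128" by simp
  have "cmod (deriv k w) \<le> 2 * (1 / s ^ 1)"
    using est[of 1 "1 / s ^ 1"] order_trans[OF B1_deriv1_bound[OF f(1) w], of "1 / s"]
      order_trans[OF B1_deriv1_bound[OF f(1) rw(1)], of "1 / s"] fr[of w 1 1] fr[OF rs, of 1 1] by (simp add: s_def)
  also have "\<dots> \<le> 2 * (1 * 2 ^ 1 / t ^ 1)" using st[of 1 1] by simp
  also have "\<dots> \<le> 128 / t" using t by (simp add: field_simps)
  finally show "cmod (deriv k w) \<le> 128 / (1 - (cmod w)\<^sup>2)" by (simp add: t_def)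
  have "cmod (deriv (deriv k) w) \<le> 2 * (1 / s ^ 2)"
    using est[of 2 "1 / s ^ 2"] order_trans[OF B1_deriv2_bound[OF f(1) w], of "1 / s\<^sup>2"]
      order_trans[OF B1_deriv2_bound[OF f(1) rw(1)], of "1 / s\<^sup>2"] fr[of w 1 2] fr[OF rs, of 1 2]
    by (simp add: s_def eval_nat_numeral)
  also have "\<dots> \<le> 2 * (1 * 2 ^ 2 / t ^ 2)" using st[of 1 2] by simp
  also have "\<dots> \<le> 128 / t\<^sup>2" using t by (simp add: field_simps)
  finally show "cmod (deriv (deriv k) w) \<le> 128 / (1 - (cmod w)\<^sup>2)\<^sup>2" by (simp add: t_def)
  have "cmod (deriv (deriv (deriv k)) w) \<le> 2 * (8 / s ^ 3)"
    using est[of 3 "8 / s ^ 3"] order_trans[OF B1_deriv3_bound[OF f(1) w], of "8 / s ^ 3"]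
      order_trans[OF B1_deriv3_bound[OF f(1) rw(1)], of "8 / s ^ 3"] fr[of w 8 3] fr[OF rs, of 8 3]
    by (simp add: s_def eval_nat_numeral)
  also have "\<dots> \<le> 2 * (8 * 2 ^ 3 / t ^ 3)" using st[of 8 3] by simp
  finally show "cmod (deriv (deriv (deriv k)) w) \<le> 128 / (1 - (cmod w)\<^sup>2) ^ 3" by (simp add: t_def)
qed

section \<open>Upper estimate of the essential norm\<close>

context bounded_operator
begin

lemma T_diff_eq:
  assumes "f holomorphic_on disc" "g holomorphic_on disc" "z \<in> disc"
  shows "T f z - T g z = T (\<lambda>w. 1 * f w + (-1) * g w) z"
  using T_lincomb[OF assms, of 1 "-1"] by simp

text \<open>The sup bound makes a norm-bounded sequence uniformly bounded on the disc, so Montel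
  gives a subsequence converging uniformly on the disc of radius R > r. Its limit \<open>g\<close>
  is merely known to be holomorphic, but \<open>dil r g\<close> lies in \<open>B1\<close>, and the
  dilations converge to it in norm.\<close>

lemma compact_T_dil:
  assumes r: "0 < r" "r < 1"
  shows "compact_B1_Z \<alpha> (\<lambda>f. T (dil r f))"
proof -
  have lin: "T (dil r (\<lambda>w. a * f w + b * g w)) z = a * T (dil r f) z + b * T (dil r g) z"
    if "f \<in> B1" "g \<in> B1" "z \<in> disc" for f g a b z
    using T_lincomb[OF dil_holo[OF r B1_holo[OF that(1)]] dil_holo[OF r B1_holo[OF that(2)]] that(3), of a b]
    by (simp add: dil_def)
  have "\<exists>s g. strict_mono s \<and> g \<in> Zspace \<alpha> \<and> (\<lambda>n. Z_norm \<alpha> (\<lambda>z. T (dil r (F (s n))) z - g z)) \<longlonglongrightarrow> 0"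
    if F: "\<And>n. F n \<in> B1" and bdd: "bounded (range (\<lambda>n. B1_norm (F n)))" for F :: "nat \<Rightarrow> complex \<Rightarrow> complex"
  proof -
    obtain L where L: "\<And>n. B1_norm (F n) \<le> L"
      using bdd unfolding bounded_iff by (metis abs_le_D1 range_eqI real_norm_def)
    obtain g s where g: "g holomorphic_on disc" and s: "strict_mono (s :: nat \<Rightarrow> nat)"
      and ul: "\<And>K. compact K \<Longrightarrow> K \<subseteq> disc \<Longrightarrow> uniform_limit K (F \<circ> s) g sequentially"
    proof (rule Montel[of disc "range F" F])
      fix K :: "complex set" assume "compact K" "K \<subseteq> disc"
      have "cmod (F n z) \<le> 9 * L" if "z \<in> K" for n z
      proof -
        have "z \<in> disc" using that \<open>K \<subseteq> disc\<close> by blast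
        from B1_sup_bound[OF F this, of n] L[of n] show ?thesis by linarith
      qed
      then have "\<forall>h\<in>range F. \<forall>z\<in>K. cmod (h z) \<le> 9 * L" by blast
      then show "\<exists>B. \<forall>h\<in>range F. \<forall>z\<in>K. cmod (h z) \<le> B" by blast
    qed (use F B1_holo in auto)
    define R where "R = (1 + r) / 2"
    have R: "r < R" "R < 1" using r by (auto simp: R_def)
    define c where "c = 1 + 1 / (R - r) + 2 / (R - r)\<^sup>2"
    have c: "c > 0" using R by (auto simp: c_def intro!: add_pos_nonneg)
    have sup: "uniform_limit (cball 0 R) (F \<circ> s) g sequentially"
      by (rule ul) (use R in auto)
    have gB: "dil r g \<in> B1" by (rule dil_B1[OF r g])
    have FB: "dil r (F n) \<in> B1" for n by (rule dil_B1[OF r B1_holo[OF F]])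
    have "(\<lambda>n. Z_norm \<alpha> (\<lambda>z. T (dil r (F (s n))) z - T (dil r g) z)) \<longlonglongrightarrow> 0"
    proof (rule LIMSEQ_I)
      fix e :: real assume e: "e > 0"
      \<comment> \<open>Chosen to make M * (\<epsilon> * c) equal to e / 2, hence strictly below
        e.\<close>
      define \<epsilon> where "\<epsilon> = e / (2 * M * c)"
      have \<epsilon>: "\<epsilon> > 0" using e M_pos c by (simp add: \<epsilon>_def)
      obtain n0 where n0: "\<And>n x. n \<ge> n0 \<Longrightarrow> x \<in> cball 0 R \<Longrightarrow> dist ((F \<circ> s) n x) (g x) < \<epsilon>"
        using sup \<epsilon> unfolding uniform_limit_iff eventually_sequentially by metis
      show "\<exists>n0. \<forall>n\<ge>n0. norm (Z_norm \<alpha> (\<lambda>z. T (dil r (F (s n))) z - T (dil r g) z) - 0) < e"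
      proof (intro exI allI impI)
        fix n assume n: "n \<ge> n0"
        define k where "k = (\<lambda>w. 1 * F (s n) w + (-1) * g w)"
        have kh: "k holomorphic_on disc" unfolding k_def by (intro holomorphic_intros g B1_holo F)
        have kb: "cmod (k w) \<le> \<epsilon>" if "w \<in> cball 0 R" for w
          using n0[OF n that] by (simp add: k_def dist_norm)
        note kB = dil_B1_norm[OF r R kh kb]
        have eq: "T (dil r (F (s n))) z - T (dil r g) z = T (dil r k) z" if "z \<in> disc" for z
          using T_diff_eq[OF B1_holo[OF FB] B1_holo[OF gB] that] by (simp add: dil_def k_def)
        have "Z_norm \<alpha> (\<lambda>z. T (dil r (F (s n))) z - T (dil r g) z) = Z_norm \<alpha> (T (dil r k))"
          by (rule Zspace_cong(2)) (rule eq)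
        moreover have "0 \<le> Z_norm \<alpha> (T (dil r k))" by (rule Z_norm_nonneg[OF T_Zspace[OF kB(1)]])
        moreover have "Z_norm \<alpha> (T (dil r k)) \<le> M * (\<epsilon> * c)"
          unfolding c_def by (rule order_trans[OF T_bound[OF kB(1)] mult_left_mono[OF kB(2) less_imp_le[OF M_pos]]])
        moreover have "M * (\<epsilon> * c) = e / 2" using M_pos c by (simp add: \<epsilon>_def)
        ultimately show "norm (Z_norm \<alpha> (\<lambda>z. T (dil r (F (s n))) z - T (dil r g) z) - 0) < e"
          using e by simp
      qed
    qed
    with s T_Zspace[OF gB] show ?thesis by blast
  qed
  with lin dil_B1[OF r B1_holo] T_Zspace show ?thesis unfolding compact_B1_Z_def by blast
qed

text \<open>Compactness is formulated by sequences, so boundedness must be derived: images of norm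
  above n have no convergent subsequence. It ensures that the real supremum in the operator norm is
  over a bounded set.\<close>

lemma compact_bounded:
  assumes K: "compact_B1_Z \<alpha> K"
  shows "\<exists>L. \<forall>f\<in>B1. B1_norm f \<le> 1 \<longrightarrow> Z_norm \<alpha> (K f) \<le> L"
proof (rule ccontr)
  assume "\<not> ?thesis"
  then have "\<forall>n::nat. \<exists>f. f \<in> B1 \<and> B1_norm f \<le> 1 \<and> \<not> Z_norm \<alpha> (K f) \<le> real n" by blast
  then obtain F where F: "\<And>n. F n \<in> B1" "\<And>n. B1_norm (F n) \<le> 1" "\<And>n. Z_norm \<alpha> (K (F n)) > real n"
    by (metis not_le)
  have "bounded (range (\<lambda>n. B1_norm (F n)))"
    using F(2) B1_norm_nonneg by (intro boundedI[of _ 1]) auto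
  then obtain s g where s: "strict_mono s" and g: "g \<in> Zspace \<alpha>"
    and lim: "(\<lambda>n. Z_norm \<alpha> (\<lambda>z. K (F (s n)) z - g z)) \<longlonglongrightarrow> 0"
    using K F(1) unfolding compact_B1_Z_def by blast
  have KF: "K (F n) \<in> Zspace \<alpha>" for n using K F(1) by (simp add: compact_B1_Z_def)
  have "eventually (\<lambda>n. Z_norm \<alpha> (\<lambda>z. K (F (s n)) z - g z) < 1) sequentially"
    using order_tendstoD(2)[OF lim] by simp
  moreover have "eventually (\<lambda>n. real n > 1 + Z_norm \<alpha> g) sequentially"
    using filterlim_real_sequentially by (simp add: filterlim_at_top_dense)
  ultimately have "eventually (\<lambda>n. Z_norm \<alpha> (\<lambda>z. K (F (s n)) z - g z) < 1 \<and> real n > 1 + Z_norm \<alpha> g) sequentially"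
    by (rule eventually_conj)
  then obtain n where n: "Z_norm \<alpha> (\<lambda>z. K (F (s n)) z - g z) < 1" "real n > 1 + Z_norm \<alpha> g"
    using eventually_happens'[OF sequentially_bot] by blast
  have d: "(\<lambda>z. K (F (s n)) z - g z) \<in> Zspace \<alpha>"
    using Zspace_lincomb(1)[OF KF g, of 1 _ "-1"] by simp
  have "Z_norm \<alpha> (K (F (s n))) \<le> Z_norm \<alpha> (\<lambda>z. K (F (s n)) z - g z) + Z_norm \<alpha> g"
    using Zspace_lincomb(2)[OF d g, of 1 1] by simp
  moreover have "real n \<le> real (s n)" using seq_suble[OF s] by simp
  ultimately show False using n F(3)[of "s n"] by linarith
qed

lemma opnorm_diff_upper:
  assumes K: "compact_B1_Z \<alpha> K" and f: "f \<in> B1" "B1_norm f \<le> 1"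
  shows "Z_norm \<alpha> (\<lambda>z. T f z - K f z) \<le> opnorm_B1_Z \<alpha> (\<lambda>f z. T f z - K f z)"
proof -
  obtain L where L: "\<And>f. f \<in> B1 \<Longrightarrow> B1_norm f \<le> 1 \<Longrightarrow> Z_norm \<alpha> (K f) \<le> L"
    using compact_bounded[OF K] by blast
  have "Z_norm \<alpha> (\<lambda>z. T f z - K f z) \<le> M + L" if f: "f \<in> B1" "B1_norm f \<le> 1" for f
  proof -
    have "K f \<in> Zspace \<alpha>" using K f by (simp add: compact_B1_Z_def)
    from Zspace_lincomb(2)[OF T_Zspace[OF f(1)] this, of 1 "-1"]
    have "Z_norm \<alpha> (\<lambda>z. T f z - K f z) \<le> Z_norm \<alpha> (T f) + Z_norm \<alpha> (K f)" by simp
    moreover have "Z_norm \<alpha> (T f) \<le> M * 1"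
      using T_bound[OF f(1)] mult_left_mono[OF f(2), of M] M_pos by linarith
    ultimately show ?thesis using L[OF f] by linarith
  qed
  then have "bdd_above {Z_norm \<alpha> (\<lambda>z. T f z - K f z) | f. f \<in> B1 \<and> B1_norm f \<le> 1}"
    by (intro bdd_aboveI[of _ "M + L"]) blast
  then show ?thesis unfolding opnorm_B1_Z_def by (intro cSup_upper) (use f in blast)
qed

section \<open>The essential norm as an infimum of real numbers\<close>

lemma zero_B1: "(\<lambda>_. 0) \<in> B1" "B1_norm (\<lambda>_. 0) \<le> 1"
  using B1_of_bounded_deriv2[of "\<lambda>_. 0" 0] by auto

text \<open>Provides the lower bound under which the real infimum in the essential norm can be
  compared with its members.\<close>

lemma opnorm_diff_nonneg:
  assumes K: "compact_B1_Z \<alpha> K"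
  shows "opnorm_B1_Z \<alpha> (\<lambda>f z. T f z - K f z) \<ge> 0"
proof -
  have "K (\<lambda>_. 0) \<in> Zspace \<alpha>" using K zero_B1 by (simp add: compact_B1_Z_def)
  from Zspace_lincomb(1)[OF T_Zspace[OF zero_B1(1)] this, of 1 "-1"]
  have "(\<lambda>z. T (\<lambda>_. 0) z - K (\<lambda>_. 0) z) \<in> Zspace \<alpha>" by simp
  from Z_norm_nonneg[OF this] opnorm_diff_upper[OF K zero_B1] show ?thesis by linarith
qed

lemma ess_norm_le:
  assumes K: "compact_B1_Z \<alpha> K"
    and B: "\<And>f. f \<in> B1 \<Longrightarrow> B1_norm f \<le> 1 \<Longrightarrow> Z_norm \<alpha> (\<lambda>z. T f z - K f z) \<le> B"
  shows "ess_norm_B1_Z \<alpha> T \<le> B"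
proof -
  have "ess_norm_B1_Z \<alpha> T \<le> opnorm_B1_Z \<alpha> (\<lambda>f z. T f z - K f z)"
    unfolding ess_norm_B1_Z_def
    by (rule cInf_lower) (use K opnorm_diff_nonneg in \<open>auto intro!: bdd_belowI[of _ 0]\<close>)
  also have "\<dots> \<le> B"
    unfolding opnorm_B1_Z_def by (rule cSup_least) (use B zero_B1 in blast)+
  finally show ?thesis .
qed

lemma ess_norm_ge:
  assumes "\<And>K. compact_B1_Z \<alpha> K \<Longrightarrow> B \<le> opnorm_B1_Z \<alpha> (\<lambda>f z. T f z - K f z)"
  shows "B \<le> ess_norm_B1_Z \<alpha> T"
  unfolding ess_norm_B1_Z_def
  \<comment> \<open>The infimum must be over a non-empty set; the dilation by 1/2 supplies a compact
    operator.\<close>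
  by (rule cInf_greatest) (use assms compact_T_dil[of "1/2"] in auto)

text \<open>\<open>E1\<close> and \<open>E2\<close> are the integrands of the two limsups: the four
  coefficients of (T f)'', the i-th divided by the power (1 - |\<phi>|^2)^i that matches the growth
  of the i-th derivative of \<open>f\<close>.\<close>

definition E1 :: "complex \<Rightarrow> real" where
  "E1 z = (1 - (cmod z)\<^sup>2) powr \<alpha> *
     (cmod (deriv (deriv u) z)
      + cmod (2 * deriv u z * deriv \<phi> z + u z * deriv (deriv \<phi>) z + deriv (deriv v) z) / (1 - (cmod (\<phi> z))\<^sup>2))"

definition E2 :: "complex \<Rightarrow> real" where
  "E2 z = (1 - (cmod z)\<^sup>2) powr \<alpha> *
     (cmod (u z * (deriv \<phi> z)\<^sup>2 + 2 * deriv v z * deriv \<phi> z + v z * deriv (deriv \<phi>) z) / (1 - (cmod (\<phi> z))\<^sup>2)\<^sup>2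
      + cmod (v z * (deriv \<phi> z)\<^sup>2) / (1 - (cmod (\<phi> z))\<^sup>2) ^ 3)"

lemma Zweight_T_dil_diff:
  assumes r: "0 < r" "r < 1" and f: "f \<in> B1" "B1_norm f \<le> 1" and z: "z \<in> disc"
  shows "Zweight \<alpha> (T (\<lambda>w. 1 * f w + (-1) * dil r f w)) z \<le> 128 * (E1 z + E2 z)"
proof -
  define k where "k = (\<lambda>w. 1 * f w + (-1) * dil r f w)"
  define t where "t = 1 - (cmod (\<phi> z))\<^sup>2"
  define W where "W = (1 - (cmod z)\<^sup>2) powr \<alpha>"
  define c0 c1 c2 c3 where "c0 = deriv (deriv u) z"
    and "c1 = 2 * deriv u z * deriv \<phi> z + u z * deriv (deriv \<phi>) z + deriv (deriv v) z"
    and "c2 = u z * (deriv \<phi> z)\<^sup>2 + 2 * deriv v z * deriv \<phi> z + v z * deriv (deriv \<phi>) z"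
    and "c3 = v z * (deriv \<phi> z)\<^sup>2"
  have kh: "k holomorphic_on disc" unfolding k_def by (intro holomorphic_intros dil_holo r B1_holo f)
  have g: "cmod (k (\<phi> z)) \<le> 128" "cmod (deriv k (\<phi> z)) \<le> 128 / t"
    "cmod (deriv (deriv k) (\<phi> z)) \<le> 128 / t\<^sup>2" "cmod (deriv (deriv (deriv k)) (\<phi> z)) \<le> 128 / t ^ 3"
    unfolding k_def t_def by (rule dil_diff_growth[OF r f \<phi>_disc[OF z]])+
  have m: "cmod (c * x) \<le> cmod c * X" if "cmod x \<le> X" for c x X
    using that by (simp add: norm_mult mult_left_mono)
  have "deriv (deriv (T k)) z = c0 * k (\<phi> z) + c1 * deriv k (\<phi> z) + c2 * deriv (deriv k) (\<phi> z) + c3 * deriv (deriv (deriv k)) (\<phi> z)"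
    by (simp add: deriv2_T[OF kh z] c0_def c1_def c2_def c3_def)
  also have "cmod \<dots> \<le> cmod (c0 * k (\<phi> z)) + cmod (c1 * deriv k (\<phi> z)) + cmod (c2 * deriv (deriv k) (\<phi> z)) + cmod (c3 * deriv (deriv (deriv k)) (\<phi> z))"
    by (intro order_trans[OF norm_triangle_ineq] add_mono order_refl)
  also have "\<dots> \<le> cmod c0 * 128 + cmod c1 * (128 / t) + cmod c2 * (128 / t\<^sup>2) + cmod c3 * (128 / t ^ 3)"
    by (intro add_mono m g)
  finally have "cmod (deriv (deriv (T k)) z) \<le> 128 * (cmod c0 + cmod c1 / t + (cmod c2 / t\<^sup>2 + cmod c3 / t ^ 3))"
    by (simp add: algebra_simps)
  then have "Zweight \<alpha> (T k) z \<le> W * (128 * (cmod c0 + cmod c1 / t + (cmod c2 / t\<^sup>2 + cmod c3 / t ^ 3)))"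
    unfolding Zweight_def W_def by (intro mult_left_mono) auto
  also have "\<dots> = 128 * (E1 z + E2 z)"
    by (simp add: E1_def E2_def c0_def c1_def c2_def c3_def t_def W_def algebra_simps)
  finally show ?thesis by (simp add: k_def)
qed

text \<open>One dilation close to the identity does it. Where |\<phi> z| <= \<delta>, and for the
  origin terms, the jet estimate is small for r near 1; elsewhere the growth estimate gives 128 (E1
  + E2) <= 256 b for every r.\<close>

lemma ess_norm_upper:
  assumes \<delta>: "0 \<le> \<delta>" "\<delta> < 1" and \<phi>0: "cmod (\<phi> 0) \<le> \<delta>" and b: "b \<ge> 0"
    and E: "\<And>z. z \<in> disc \<Longrightarrow> \<delta> < cmod (\<phi> z) \<Longrightarrow> E1 z \<le> b \<and> E2 z \<le> b"
  shows "ess_norm_B1_Z \<alpha> T \<le> 256 * b"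
proof (rule field_le_epsilon)
  fix \<epsilon> :: real assume \<epsilon>: "\<epsilon> > 0"
  define \<rho> where "\<rho> = (1 - \<delta>) / 2"
  have \<rho>: "\<rho> > 0" using \<delta> by (simp add: \<rho>_def)
  \<comment> \<open>The jet contributes 4 M * 24 \<eta> / \<rho>^4 = 96 M \<eta> / \<rho>^4, at most
    \<epsilon> / 2 by this choice; it is spent once on the origin terms and once on the weight. The
    minimum with 1/2 keeps r positive.\<close>
  define \<eta> where "\<eta> = min (1 / 2) (\<epsilon> * \<rho> ^ 4 / (192 * M))"
  have \<eta>: "0 < \<eta>" "\<eta> \<le> 1 / 2" "\<eta> \<le> \<epsilon> * \<rho> ^ 4 / (192 * M)" using \<epsilon> \<rho> M_pos by (auto simp: \<eta>_def)
  define r where "r = 1 - \<eta>"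
  have r: "0 < r" "r < 1" using \<eta> by (auto simp: r_def)
  have small: "4 * M * (24 * (1 - r) / \<rho> ^ 4) \<le> \<epsilon> / 2"
  proof -
    have "\<eta> * (192 * M) \<le> \<epsilon> * \<rho> ^ 4" using \<eta>(3) M_pos by (simp add: field_simps)
    then show ?thesis using \<rho> by (simp add: r_def field_simps)
  qed
  show "ess_norm_B1_Z \<alpha> T \<le> 256 * b + \<epsilon>"
  proof (rule ess_norm_le[OF compact_T_dil[OF r]])
    fix f assume f: "f \<in> B1" "B1_norm f \<le> 1"
    define k where "k = (\<lambda>w. 1 * f w + (-1) * dil r f w)"
    have kh: "k holomorphic_on disc" unfolding k_def by (intro holomorphic_intros dil_holo r B1_holo f)
    have jet: "4 * M * jet_sum k w \<le> \<epsilon> / 2" if "cmod w \<le> \<delta>" for w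
    proof -
      have "jet_sum k w \<le> 24 * (1 - r) / \<rho> ^ 4"
        unfolding k_def \<rho>_def by (rule dil_diff_jet[OF r \<delta> f that])
      then have "4 * M * jet_sum k w \<le> 4 * M * (24 * (1 - r) / \<rho> ^ 4)"
        using M_pos by (intro mult_left_mono) auto
      with small show ?thesis by linarith
    qed
    have eq: "Z_norm \<alpha> (\<lambda>z. T f z - T (dil r f) z) = Z_norm \<alpha> (T k)"
      unfolding k_def by (rule Zspace_cong(2)) (rule T_diff_eq[OF B1_holo[OF f(1)] dil_holo[OF r B1_holo[OF f(1)]]])
    have "Z_norm \<alpha> (T k) \<le> 256 * b + \<epsilon>"
    proof (rule Z_norm_le)
      fix z :: complex assume z: "z \<in> disc"
      have "Zweight \<alpha> (T k) z \<le> 256 * b + \<epsilon> / 2"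
      proof (cases "cmod (\<phi> z) \<le> \<delta>")
        case True
        then show ?thesis using Zweight_T_jet[OF kh z] jet[OF True] b by linarith
      next
        case False
        then show ?thesis using Zweight_T_dil_diff[OF r f z, folded k_def] E[OF z] \<epsilon> by simp
      qed
      then show "Zpart \<alpha> (T k) z \<le> 256 * b + \<epsilon>"
        using T_origin_jet[OF kh] jet[OF \<phi>0] unfolding Zpart_def by linarith
    qed
    then show "Z_norm \<alpha> (\<lambda>z. T f z - T (dil r f) z) \<le> 256 * b + \<epsilon>" using eq by simp
  qed
qed

end

section \<open>Lower estimate of the essential norm\<close>

lemma eventually_to_boundary:
  "eventually P to_boundary \<longleftrightarrow> (\<exists>\<delta><1. \<forall>a. \<delta> < cmod a \<and> cmod a < 1 \<longrightarrow> P a)"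
proof -
  have "eventually P to_boundary \<longleftrightarrow> (\<exists>Q. (\<exists>\<delta><1. \<forall>y. \<delta> < y \<and> y < 1 \<longrightarrow> Q y) \<and> (\<forall>a. Q (cmod a) \<longrightarrow> P a))"
    unfolding to_boundary_def eventually_filtercomap eventually_at_left_field by (simp add: conj_commute imp_conjL)
  also have "\<dots> \<longleftrightarrow> (\<exists>\<delta><1. \<forall>a. \<delta> < cmod a \<and> cmod a < 1 \<longrightarrow> P a)"
  proof
    assume "\<exists>\<delta><1. \<forall>a. \<delta> < cmod a \<and> cmod a < 1 \<longrightarrow> P a"
    then obtain \<delta> where "\<delta> < 1" "\<forall>a. \<delta> < cmod a \<and> cmod a < 1 \<longrightarrow> P a" by blast
    then show "\<exists>Q. (\<exists>\<delta><1. \<forall>y. \<delta> < y \<and> y < 1 \<longrightarrow> Q y) \<and> (\<forall>a. Q (cmod a) \<longrightarrow> P a)"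
      by (intro exI[of _ "\<lambda>y. \<delta> < y \<and> y < 1"]) auto
  qed blast
  finally show ?thesis .
qed

text \<open>If |\<phi>| stays away from 1, a suitable \<open>\<delta>\<close> makes the condition
  vacuous; the filter is then trivial and \<open>limsup0\<close> takes the value 0.\<close>

lemma eventually_phi_to_boundary:
  "eventually P (phi_to_boundary \<phi>) \<longleftrightarrow> (\<exists>\<delta><1. \<forall>z\<in>disc. \<delta> < cmod (\<phi> z) \<and> cmod (\<phi> z) < 1 \<longrightarrow> P z)"
proof -
  have "eventually P (phi_to_boundary \<phi>) \<longleftrightarrow> (\<exists>Q. (\<exists>\<delta><1. \<forall>y. \<delta> < y \<and> y < 1 \<longrightarrow> Q y) \<and> (\<forall>z. Q (cmod (\<phi> z)) \<longrightarrow> z \<in> disc \<longrightarrow> P z))"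
    unfolding phi_to_boundary_def eventually_inf_principal eventually_filtercomap eventually_at_left_field
    by (simp add: conj_commute imp_conjL)
  also have "\<dots> \<longleftrightarrow> (\<exists>\<delta><1. \<forall>z\<in>disc. \<delta> < cmod (\<phi> z) \<and> cmod (\<phi> z) < 1 \<longrightarrow> P z)"
  proof
    assume "\<exists>\<delta><1. \<forall>z\<in>disc. \<delta> < cmod (\<phi> z) \<and> cmod (\<phi> z) < 1 \<longrightarrow> P z"
    then obtain \<delta> where "\<delta> < 1" "\<forall>z\<in>disc. \<delta> < cmod (\<phi> z) \<and> cmod (\<phi> z) < 1 \<longrightarrow> P z" by blast
    then show "\<exists>Q. (\<exists>\<delta><1. \<forall>y. \<delta> < y \<and> y < 1 \<longrightarrow> Q y) \<and> (\<forall>z. Q (cmod (\<phi> z)) \<longrightarrow> z \<in> disc \<longrightarrow> P z)"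
      by (intro exI[of _ "\<lambda>y. \<delta> < y \<and> y < 1"]) auto
  qed blast
  finally show ?thesis .
qed

lemma limsup0_le:
  assumes "0 \<le> B" "eventually (\<lambda>x. f x \<le> B) F"
  shows "limsup0 F f \<le> B"
  using assms by (simp add: limsup0_def Limsup_bounded)

lemma limsup0_lessD:
  assumes "limsup0 F f < B"
  shows "eventually (\<lambda>x. f x < B) F"
  using assms Limsup_lessD[of F f B] by (simp add: limsup0_def)

text \<open>At a fixed \<open>w\<close> the denominators stay above powers of 1 - |w|, while the
  numerator carries (1 - |a|^2)^j with j >= 1. This pointwise decay is what takes the place of weak
  convergence.\<close>

lemma test_fn_jet_tendsto:
  assumes w: "w \<in> disc" and a: "\<And>n. cmod (a n) < 1" "(\<lambda>n. cmod (a n)) \<longlonglongrightarrow> 1" and j: "j \<ge> 1"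
  shows "(\<lambda>n. jet_sum (test_fn j (a n)) w) \<longlonglongrightarrow> 0"
proof -
  define s where "s = 1 - cmod w"
  have s: "s > 0" using w by (simp add: s_def)
  have D: "(\<lambda>n. 1 - (cmod (a n))\<^sup>2) \<longlonglongrightarrow> 0"
    using tendsto_diff[OF tendsto_const[of 1] tendsto_power[OF a(2), of 2]] by simp
  have lim: "(\<lambda>n. cmod ((deriv ^^ i) (test_fn j (a n)) w)) \<longlonglongrightarrow> 0" for i
  proof (rule tendsto_sandwich[OF _ _ tendsto_const])
    show "\<forall>\<^sub>F n in sequentially. cmod ((deriv ^^ i) (test_fn j (a n)) w)
        \<le> cmod (pochhammer (of_nat j) i) / s ^ (j + i) * (1 - (cmod (a n))\<^sup>2)"
    proof (intro always_eventually allI)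
      fix n
      define D where "D = 1 - (cmod (a n))\<^sup>2"
      have D: "0 < D" "D \<le> 1" using a(1)[of n] by (auto simp: D_def abs_square_less_1)
      have "cmod ((deriv ^^ i) (test_fn j (a n)) w)
        = cmod (pochhammer (of_nat j) i) * cmod (a n) ^ i * D ^ j / cmod (1 - cnj (a n) * w) ^ (j + i)"
        using D by (simp add: higher_deriv_test_fn[OF a(1) w] D_def[symmetric] norm_mult norm_divide norm_power del: of_real_power of_real_diff)
      also have "\<dots> \<le> cmod (pochhammer (of_nat j) i) * 1 * D ^ 1 / s ^ (j + i)"
        using D a(1)[of n] s one_minus_cnj_mult(3)[OF a(1) w, of n] j
        by (intro frac_le mult_mono power_mono power_decreasing mult_nonneg_nonneg power_le_one) (auto simp: s_def)
      finally show "cmod ((deriv ^^ i) (test_fn j (a n)) w) \<le> cmod (pochhammer (of_nat j) i) / s ^ (j + i) * (1 - (cmod (a n))\<^sup>2)"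
        by (simp add: D_def)
    qed
    show "(\<lambda>n. cmod (pochhammer (of_nat j) i) / s ^ (j + i) * (1 - (cmod (a n))\<^sup>2)) \<longlonglongrightarrow> 0"
      using tendsto_mult_left[OF D, of "cmod (pochhammer (of_nat j) i) / s ^ (j + i)"] by simp
  qed (auto intro: always_eventually)
  have "(\<lambda>n. jet_sum (test_fn j (a n)) w) \<longlonglongrightarrow> 0 + 0 + 0 + 0"
    unfolding jet_sum_def using lim[of 0] lim[of 1] lim[of 2] lim[of 3]
    by (intro tendsto_add) (simp_all add: numeral_2_eq_2 numeral_3_eq_3)
  then show ?thesis by simp
qed

text \<open>The left-hand side is a cubic polynomial in j written in the basis of rising factorials,
  so its values \<open>y\<close> at 1, 2, 3, 4 determine the coefficients: \<open>x0\<close> is the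
  value extrapolated to j = 0 and \<open>x3\<close> the third difference over 6. The rows of the
  inverse have absolute sums 15, 34, 14 and 4/3, whence 34.\<close>

lemma rising_factorial_system_bounds:
  fixes x0 x1 x2 x3 :: complex
  assumes S: "\<And>j. j \<in> {1..4::nat} \<Longrightarrow> cmod (x0 + of_nat j * x1 + of_nat (j * (j + 1)) * x2 + of_nat (j * (j + 1) * (j + 2)) * x3) \<le> s"
  shows "cmod x0 \<le> 34 * s" "cmod x1 \<le> 34 * s" "cmod x2 \<le> 34 * s" "cmod x3 \<le> 34 * s"
proof -
  define y where "y = (\<lambda>j::nat. x0 + of_nat j * x1 + of_nat (j * (j + 1)) * x2 + of_nat (j * (j + 1) * (j + 2)) * x3)"
  have y: "cmod (y j) \<le> s" if "j \<in> {1..4}" for j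
    using S[OF that] by (simp only: y_def)
  have s0: "s \<ge> 0" using order_trans[OF norm_ge_zero y[of 1]] by simp
  have n4: "cmod (a * y 1 + b * y 2 + c * y 3 + d * y 4) \<le> 34 * s" if "cmod a + cmod b + cmod c + cmod d \<le> 34" for a b c d
  proof -
    have "cmod (a * y 1 + b * y 2 + c * y 3 + d * y 4) \<le> cmod (a * y 1) + cmod (b * y 2) + cmod (c * y 3) + cmod (d * y 4)"
      by (intro order_trans[OF norm_triangle_ineq] add_mono order_refl)
    also have "\<dots> \<le> cmod a * s + cmod b * s + cmod c * s + cmod d * s"
      unfolding norm_mult by (intro add_mono mult_left_mono y norm_ge_zero) auto
    also have "\<dots> = (cmod a + cmod b + cmod c + cmod d) * s" by (simp add: algebra_simps)
    also have "\<dots> \<le> 34 * s" by (rule mult_right_mono[OF that s0])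
    finally show ?thesis .
  qed
  have yv: "y 1 = x0 + x1 + 2 * x2 + 6 * x3" "y 2 = x0 + 2 * x1 + 6 * x2 + 24 * x3"
    "y 3 = x0 + 3 * x1 + 12 * x2 + 60 * x3" "y 4 = x0 + 4 * x1 + 20 * x2 + 120 * x3"
    by (simp_all add: y_def)
  have "x0 = 4 * y 1 + (-6) * y 2 + 4 * y 3 + (-1) * y 4" unfolding yv by (simp add: algebra_simps)
  then show "cmod x0 \<le> 34 * s" using n4[of 4 "-6" 4 "-1"] by simp
  have "x1 = (-6) * y 1 + 14 * y 2 + (-11) * y 3 + 3 * y 4" unfolding yv by (simp add: algebra_simps)
  then show "cmod x1 \<le> 34 * s" using n4[of "-6" 14 "-11" 3] by simp
  have "x2 = 2 * y 1 + (-11/2) * y 2 + 5 * y 3 + (-3/2) * y 4" unfolding yv by (simp add: field_simps)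
  then show "cmod x2 \<le> 34 * s" using n4[of 2 "-11/2" 5 "-3/2"] by (simp add: norm_divide)
  have "x3 = (-1/6) * y 1 + (1/2) * y 2 + (-1/2) * y 3 + (1/6) * y 4" unfolding yv by (simp add: field_simps)
  then show "cmod x3 \<le> 34 * s" using n4[of "-1/6" "1/2" "-1/2" "1/6"] by (simp add: norm_divide)
qed

context bounded_operator
begin

text \<open>The difference of two test functions isolates T(G m) up to K(G m) - K(G n), which is
  nearly 0, and T(G n), which is small only at each fixed point. So \<open>n\<close> goes to
  infinity with \<open>m\<close> and \<open>z\<close> fixed, next comes the supremum over
  \<open>z\<close>, and \<open>m\<close> goes to infinity last.\<close>

lemma test_fn_limsup_le_opnorm:
  assumes K: "compact_B1_Z \<alpha> K" and j: "j \<in> {1..4}"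
  defines "S \<equiv> opnorm_B1_Z \<alpha> (\<lambda>f z. T f z - K f z)"
  assumes y: "y > 6000 * S"
  shows "eventually (\<lambda>a. Z_norm \<alpha> (T (test_fn j a)) \<le> y) to_boundary"
proof (rule ccontr)
  assume neg: "\<not> ?thesis"
  have "\<exists>a. 1 - inverse (real (Suc n)) < cmod a \<and> cmod a < 1 \<and> \<not> Z_norm \<alpha> (T (test_fn j a)) \<le> y" for n
    using neg unfolding eventually_to_boundary
    by (metis (no_types, lifting) diff_less_eq inverse_positive_iff_positive less_add_same_cancel1 of_nat_0_less_iff zero_less_Suc)
  then obtain a where a: "\<And>n. 1 - inverse (real (Suc n)) < cmod (a n)" "\<And>n. cmod (a n) < 1"
    "\<And>n. Z_norm \<alpha> (T (test_fn j (a n))) > y" by (metis not_le)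
  have alim: "(\<lambda>n. cmod (a n)) \<longlonglongrightarrow> 1"
  proof (rule tendsto_sandwich)
    show "(\<lambda>n. 1 - inverse (real (Suc n))) \<longlonglongrightarrow> 1"
      using tendsto_diff[OF tendsto_const[of 1] LIMSEQ_inverse_real_of_nat] by simp
  qed (use a in \<open>auto intro!: always_eventually less_imp_le\<close>)
  define F where "F = (\<lambda>n. test_fn j (a n))"
  have F: "F n \<in> B1" "B1_norm (F n) \<le> 3000" for n using test_fn_B1[OF a(2) j] by (simp_all add: F_def)
  have "bounded (range (\<lambda>n. B1_norm (F n)))"
    using F(2) B1_norm_nonneg by (intro boundedI[of _ 3000]) auto
  then obtain s g where s: "strict_mono s" and g: "g \<in> Zspace \<alpha>"
    and lim: "(\<lambda>n. Z_norm \<alpha> (\<lambda>z. K (F (s n)) z - g z)) \<longlonglongrightarrow> 0"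
    using K F(1) unfolding compact_B1_Z_def by blast
  define G where "G = (\<lambda>n. F (s n))"
  define e where "e = (\<lambda>n. Z_norm \<alpha> (\<lambda>z. K (G n) z - g z))"
  have e: "e \<longlonglongrightarrow> 0" using lim by (simp add: e_def G_def)
  have G: "G n \<in> B1" "B1_norm (G n) \<le> 3000" for n using F by (simp_all add: G_def)
  have KZ: "K f \<in> Zspace \<alpha>" if "f \<in> B1" for f using K that by (simp add: compact_B1_Z_def)
  have Klin: "K (\<lambda>w. b * f w + c * h w) z = b * K f z + c * K h z" if "f \<in> B1" "h \<in> B1" "z \<in> disc" for f h b c z
    using K that by (simp add: compact_B1_Z_def)
  have dZ: "(\<lambda>z. f z - h z) \<in> Zspace \<alpha>" if "f \<in> Zspace \<alpha>" "h \<in> Zspace \<alpha>" for f h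
    using Zspace_lincomb(1)[OF that, of 1 "-1"] by simp
  \<comment> \<open>Each test function has norm at most 3000, so their difference divided by 6000
    lies in the unit ball. The limit \<open>g\<close> cancels between \<open>km\<close> and
    \<open>kn\<close>.\<close>
  have main: "Zpart \<alpha> (T (G m)) z \<le> 6000 * S + e m + e n + Zpart \<alpha> (T (G n)) z" if z: "z \<in> disc" for m n z
  proof -
    define h where "h = (\<lambda>w. (1 / 6000) * G m w + (-1 / 6000) * G n w)"
    have h: "h \<in> B1" unfolding h_def by (rule B1_lincomb(1)[OF G(1) G(1)])
    have "B1_norm h \<le> cmod (1 / 6000) * B1_norm (G m) + cmod (-1 / 6000) * B1_norm (G n)"
      unfolding h_def by (rule B1_lincomb(2)[OF G(1) G(1)])
    then have h1: "B1_norm h \<le> 1" using G(2)[of m] G(2)[of n] by (simp add: norm_divide)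
    define q where "q = (\<lambda>z. T h z - K h z)"
    have q: "q \<in> Zspace \<alpha>" unfolding q_def by (intro dZ T_Zspace KZ h)
    have qS: "Zpart \<alpha> q z \<le> S"
      using Zpart_le_Z_norm[OF q z] opnorm_diff_upper[OF K h h1] by (simp add: q_def S_def)
    define km where "km = (\<lambda>z. K (G m) z - g z)"
    define kn where "kn = (\<lambda>z. K (G n) z - g z)"
    have km: "km \<in> Zspace \<alpha>" unfolding km_def by (intro dZ KZ G g)
    have kn: "kn \<in> Zspace \<alpha>" unfolding kn_def by (intro dZ KZ G g)
    have kme: "Zpart \<alpha> km z \<le> e m" using Zpart_le_Z_norm[OF km z] by (simp add: e_def km_def)
    have kne: "Zpart \<alpha> kn z \<le> e n" using Zpart_le_Z_norm[OF kn z] by (simp add: e_def kn_def)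
    define r1 where "r1 = (\<lambda>z. 1 * km z + (-1) * kn z)"
    define r2 where "r2 = (\<lambda>z. 1 * T (G n) z + 1 * r1 z)"
    have r1: "r1 \<in> Zspace \<alpha>" unfolding r1_def by (rule Zspace_lincomb(1)[OF km kn])
    have r2: "r2 \<in> Zspace \<alpha>" unfolding r2_def by (rule Zspace_lincomb(1)[OF T_Zspace[OF G(1)] r1])
    have "T (G m) x = 6000 * q x + 1 * r2 x" if x: "x \<in> disc" for x
      using T_lincomb[OF B1_holo[OF G(1)] B1_holo[OF G(1)] x, of "1 / 6000" m "-1 / 6000" n, folded h_def]
        Klin[OF G(1) G(1) x, of "1 / 6000" m "-1 / 6000" n, folded h_def]
      by (simp add: q_def r2_def r1_def km_def kn_def algebra_simps)
    then have "Zpart \<alpha> (T (G m)) z = Zpart \<alpha> (\<lambda>x. 6000 * q x + 1 * r2 x) z"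
      by (rule Zpart_cong(1)[OF _ z])
    also have "\<dots> \<le> cmod 6000 * Zpart \<alpha> q z + cmod 1 * Zpart \<alpha> r2 z"
      by (rule Zpart_lincomb(1)[OF Zspace_holo[OF q] Zspace_holo[OF r2] z])
    also have "Zpart \<alpha> r2 z \<le> cmod 1 * Zpart \<alpha> (T (G n)) z + cmod 1 * Zpart \<alpha> r1 z"
      unfolding r2_def by (rule Zpart_lincomb(1)[OF Zspace_holo[OF T_Zspace[OF G(1)]] Zspace_holo[OF r1] z])
    also have "Zpart \<alpha> r1 z \<le> cmod 1 * Zpart \<alpha> km z + cmod (-1) * Zpart \<alpha> kn z"
      unfolding r1_def by (rule Zpart_lincomb(1)[OF Zspace_holo[OF km] Zspace_holo[OF kn] z])
    finally show ?thesis using qS kme kne by simp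
  qed
  have Tlim: "(\<lambda>n. Zpart \<alpha> (T (G n)) z) \<longlonglongrightarrow> 0" if z: "z \<in> disc" for z
  proof -
    have jl: "(\<lambda>n. jet_sum (G n) w) \<longlonglongrightarrow> 0" if w: "w \<in> disc" for w
      unfolding G_def F_def
      by (rule test_fn_jet_tendsto[OF w])
         (use a(2) j LIMSEQ_subseq_LIMSEQ[OF alim s] in \<open>auto simp: o_def\<close>)
    have "(\<lambda>n. 4 * M * jet_sum (G n) (\<phi> 0) + 4 * M * jet_sum (G n) (\<phi> z)) \<longlonglongrightarrow> 4 * M * 0 + 4 * M * 0"
      by (intro tendsto_intros jl \<phi>_disc z) simp
    then have l: "(\<lambda>n. 4 * M * jet_sum (G n) (\<phi> 0) + 4 * M * jet_sum (G n) (\<phi> z)) \<longlonglongrightarrow> 0" by simp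
    show ?thesis
    proof (rule tendsto_sandwich[OF _ _ tendsto_const l])
      show "\<forall>\<^sub>F n in sequentially. 0 \<le> Zpart \<alpha> (T (G n)) z"
        by (simp add: Zpart_def Zweight_nonneg)
      show "\<forall>\<^sub>F n in sequentially. Zpart \<alpha> (T (G n)) z \<le> 4 * M * jet_sum (G n) (\<phi> 0) + 4 * M * jet_sum (G n) (\<phi> z)"
        unfolding Zpart_def
        by (intro always_eventually allI add_mono T_origin_jet Zweight_T_jet B1_holo G z)
    qed
  qed
  have "y \<le> 6000 * S + e m" for m
  proof -
    have "Z_norm \<alpha> (T (G m)) \<le> 6000 * S + e m"
    proof (rule Z_norm_le)
      fix z :: complex assume z: "z \<in> disc"
      have "(\<lambda>n. 6000 * S + e m + e n + Zpart \<alpha> (T (G n)) z) \<longlonglongrightarrow> 6000 * S + e m + 0 + 0"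
        by (intro tendsto_intros e Tlim z)
      from LIMSEQ_le_const[OF this, of "Zpart \<alpha> (T (G m)) z"] main[OF z]
      show "Zpart \<alpha> (T (G m)) z \<le> 6000 * S + e m" by auto
    qed
    then show ?thesis using a(3)[of "s m"] by (simp add: G_def F_def)
  qed
  moreover have "(\<lambda>m. 6000 * S + e m) \<longlonglongrightarrow> 6000 * S + 0" by (intro tendsto_intros e)
  ultimately have "y \<le> 6000 * S" using LIMSEQ_le_const[of "\<lambda>m. 6000 * S + e m" "6000 * S" y] by auto
  with y show False by simp
qed

text \<open>Testing with a = \<phi> z, the i-th derivative at the peak is a rising factorial times
  t^i, so the unknowns of the 4 x 4 system are W c_i t^i. Passing from |t|^i to 1 / D^i costs
  |w|^(-i) <= 8, for which |w| >= 1/2 is used. This gives 8 * 34 = 272 per coefficient and 544 for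
  two.\<close>

lemma E_le_test_fn:
  assumes z: "z \<in> disc" and half: "cmod (\<phi> z) \<ge> 1 / 2"
    and s: "\<And>j. j \<in> {1..4} \<Longrightarrow> Z_norm \<alpha> (T (test_fn j (\<phi> z))) \<le> s"
  shows "E1 z \<le> 544 * s" "E2 z \<le> 544 * s"
proof -
  define w where "w = \<phi> z"
  define D where "D = 1 - (cmod w)\<^sup>2"
  define W where "W = (1 - (cmod z)\<^sup>2) powr \<alpha>"
  define c0 c1 c2 c3 where "c0 = deriv (deriv u) z"
    and "c1 = 2 * deriv u z * deriv \<phi> z + u z * deriv (deriv \<phi>) z + deriv (deriv v) z"
    and "c2 = u z * (deriv \<phi> z)\<^sup>2 + 2 * deriv v z * deriv \<phi> z + v z * deriv (deriv \<phi>) z"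
    and "c3 = v z * (deriv \<phi> z)\<^sup>2"
  define t where "t = cnj w / of_real D"
  have w: "w \<in> disc" "cmod w < 1" using \<phi>_disc[OF z] by (simp_all add: w_def)
  have D: "D > 0" using w by (simp add: D_def abs_square_less_1)
  have W: "W \<ge> 0" by (simp add: W_def)
  have wD: "1 - cnj w * w = of_real D"
    unfolding D_def of_real_diff complex_norm_square by simp
  have hd: "(deriv ^^ i) (test_fn j w) w = pochhammer (of_nat j) i * t ^ i" for i j
  proof -
    have "(deriv ^^ i) (test_fn j w) w = pochhammer (of_nat j) i * cnj w ^ i * of_real D ^ j / of_real D ^ (j + i)"
      by (simp only: higher_deriv_test_fn[OF w(2,1)] wD D_def[symmetric])
    also have "\<dots> = pochhammer (of_nat j) i * t ^ i"
      using D by (simp add: t_def power_divide power_add field_simps)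
    finally show ?thesis .
  qed
  have "cmod (of_real W * c0 + of_nat j * (of_real W * c1 * t) + of_nat (j * (j + 1)) * (of_real W * c2 * t ^ 2)
      + of_nat (j * (j + 1) * (j + 2)) * (of_real W * c3 * t ^ 3)) \<le> s" if j: "j \<in> {1..4}" for j
  proof -
    have "deriv (deriv (T (test_fn j w))) z = c0 + c1 * (of_nat j * t) + c2 * (of_nat j * (of_nat j + 1) * t ^ 2)
        + c3 * (of_nat j * (of_nat j + 1) * (of_nat j + 2) * t ^ 3)"
      using hd[where i = 0 and j = j] hd[where i = 1 and j = j] hd[where i = 2 and j = j] hd[where i = 3 and j = j]
      unfolding deriv2_T[OF test_fn_holo[OF w(2)] z] w_def[symmetric]
      by (simp add: numeral_2_eq_2 numeral_3_eq_3 pochhammer_Suc c0_def c1_def c2_def c3_def)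
    then have "of_real W * c0 + of_nat j * (of_real W * c1 * t) + of_nat (j * (j + 1)) * (of_real W * c2 * t ^ 2)
      + of_nat (j * (j + 1) * (j + 2)) * (of_real W * c3 * t ^ 3) = of_real W * deriv (deriv (T (test_fn j w))) z"
      by (simp add: algebra_simps)
    also have "cmod \<dots> = Zweight \<alpha> (T (test_fn j w)) z"
      using W by (simp add: Zweight_def W_def norm_mult)
    also have "\<dots> \<le> Zpart \<alpha> (T (test_fn j w)) z" by (simp add: Zpart_def)
    also have "\<dots> \<le> Z_norm \<alpha> (T (test_fn j w))"
      by (rule Zpart_le_Z_norm[OF T_Zspace[OF test_fn_B1(1)[OF w(2) j]] z])
    also have "\<dots> \<le> s" using s[OF j] by (simp add: w_def)
    finally show ?thesis .
  qed
  note x = rising_factorial_system_bounds[of "of_real W * c0" "of_real W * c1 * t" "of_real W * c2 * t ^ 2" "of_real W * c3 * t ^ 3" s, OF this]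
  have s0: "s \<ge> 0" using order_trans[OF norm_ge_zero x(1)] by simp
  have b: "W * (cmod c / D ^ i) \<le> 272 * s" if "cmod (of_real W * c * t ^ i) \<le> 34 * s" "i \<le> 3" for c i
  proof -
    have "(1 / 2) ^ 3 \<le> (1 / 2 :: real) ^ i" using that(2) by (intro power_decreasing) auto
    also have "\<dots> \<le> cmod w ^ i" using half by (intro power_mono) (auto simp: w_def)
    finally have "1 \<le> 8 * cmod w ^ i" by (simp add: power3_eq_cube)
    then have "W * (cmod c / D ^ i) * 1 \<le> W * (cmod c / D ^ i) * (8 * cmod w ^ i)"
      using W D by (intro mult_left_mono mult_nonneg_nonneg) auto
    also have "\<dots> = 8 * cmod (of_real W * c * t ^ i)"
      using W D by (simp add: t_def norm_mult norm_power norm_divide power_divide)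
    finally show ?thesis using that(1) by simp
  qed
  have "E1 z = W * (cmod c0 / D ^ 0) + W * (cmod c1 / D ^ 1)"
    by (simp add: E1_def W_def c0_def c1_def D_def w_def algebra_simps)
  then show "E1 z \<le> 544 * s" using b[of c0 0] b[of c1 1] x by simp
  have "E2 z = W * (cmod c2 / D ^ 2) + W * (cmod c3 / D ^ 3)"
    by (simp add: E2_def W_def c2_def c3_def D_def w_def algebra_simps)
  then show "E2 z \<le> 544 * s" using b[of c2 2] b[of c3 3] x by simp
qed

section \<open>Comparison of the limsups with the essential norm\<close>

definition A_lim :: ereal where
  "A_lim = Max ((\<lambda>j. limsup0 to_boundary (\<lambda>a. ereal (Z_norm \<alpha> (T (test_fn j a))))) ` {1..4})"

lemma A_lim_nonneg: "0 \<le> A_lim"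
proof -
  have "0 \<le> limsup0 to_boundary (\<lambda>a. ereal (Z_norm \<alpha> (T (test_fn 1 a))))" by (simp add: limsup0_def)
  also have "\<dots> \<le> A_lim" unfolding A_lim_def by (intro Max_ge) auto
  finally show ?thesis .
qed

lemma A_lim_le_ess_norm: "A_lim \<le> ereal (6000 * ess_norm_B1_Z \<alpha> T)"
proof -
  have "limsup0 to_boundary (\<lambda>a. ereal (Z_norm \<alpha> (T (test_fn j a)))) \<le> ereal (6000 * ess_norm_B1_Z \<alpha> T)"
    if j: "j \<in> {1..4}" for j
  proof (rule ereal_le_epsilon2)
    fix e :: real assume e: "0 < e"
    define y where "y = 6000 * ess_norm_B1_Z \<alpha> T + e"
    \<comment> \<open>An operator within e / 6000 of the infimum, so that multiplying by 6000
      overshoots by less than e.\<close>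
    have "\<exists>K. compact_B1_Z \<alpha> K \<and> opnorm_B1_Z \<alpha> (\<lambda>f z. T f z - K f z) < y / 6000"
    proof (rule ccontr)
      assume "\<not> ?thesis"
      then have "y / 6000 \<le> ess_norm_B1_Z \<alpha> T" by (intro ess_norm_ge) (auto simp: not_less)
      with e show False by (simp add: y_def)
    qed
    then obtain K where K: "compact_B1_Z \<alpha> K" "y > 6000 * opnorm_B1_Z \<alpha> (\<lambda>f z. T f z - K f z)"
      by (auto simp: field_simps)
    have "0 \<le> y" using opnorm_diff_nonneg[OF K(1)] K(2) by simp
    then have "limsup0 to_boundary (\<lambda>a. ereal (Z_norm \<alpha> (T (test_fn j a)))) \<le> ereal y"
      using test_fn_limsup_le_opnorm[OF K(1) j K(2)] by (intro limsup0_le) auto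
    then show "limsup0 to_boundary (\<lambda>a. ereal (Z_norm \<alpha> (T (test_fn j a)))) \<le> ereal (6000 * ess_norm_B1_Z \<alpha> T) + ereal e"
      by (simp add: y_def)
  qed
  then show ?thesis unfolding A_lim_def by (subst Max_le_iff) auto
qed

text \<open>A bound valid for all test parameters near the circle applies in particular to a =
  \<phi> z as soon as |\<phi> z| is near 1. Raising the level to at least 1/2 makes the coefficient
  estimate available.\<close>

lemma E_lim_le_A_lim:
  assumes a: "A_lim = ereal a"
  shows "limsup0 (phi_to_boundary \<phi>) (\<lambda>z. ereal (E1 z)) \<le> ereal (544 * a)"
    "limsup0 (phi_to_boundary \<phi>) (\<lambda>z. ereal (E2 z)) \<le> ereal (544 * a)"
proof -
  have a0: "a \<ge> 0" using A_lim_nonneg a by simp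
  have ev: "eventually (\<lambda>z. E1 z \<le> 544 * a + e \<and> E2 z \<le> 544 * a + e) (phi_to_boundary \<phi>)" if e: "e > 0" for e
  proof -
    define b where "b = a + e / 544"
    have "eventually (\<lambda>x. ereal (Z_norm \<alpha> (T (test_fn j x))) < ereal b) to_boundary" if "j \<in> {1..4}" for j
    proof (rule limsup0_lessD)
      have "limsup0 to_boundary (\<lambda>a. ereal (Z_norm \<alpha> (T (test_fn j a)))) \<le> A_lim"
        unfolding A_lim_def by (intro Max_ge) (use that in auto)
      also have "\<dots> < ereal b" using e by (simp add: a b_def)
      finally show "limsup0 to_boundary (\<lambda>a. ereal (Z_norm \<alpha> (T (test_fn j a)))) < ereal b" .
    qed
    then have "eventually (\<lambda>x. \<forall>j\<in>{1..4}. Z_norm \<alpha> (T (test_fn j x)) < b) to_boundary"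
      by (intro eventually_ball_finite) auto
    then obtain \<delta> where \<delta>: "\<delta> < 1" "\<And>x j. \<delta> < cmod x \<Longrightarrow> cmod x < 1 \<Longrightarrow> j \<in> {1..4} \<Longrightarrow> Z_norm \<alpha> (T (test_fn j x)) < b"
      unfolding eventually_to_boundary by blast
    show ?thesis unfolding eventually_phi_to_boundary
    proof (intro exI[of _ "max \<delta> (1 / 2)"] conjI ballI impI)
      fix z assume z: "z \<in> disc" and p: "max \<delta> (1 / 2) < cmod (\<phi> z) \<and> cmod (\<phi> z) < 1"
      have s: "Z_norm \<alpha> (T (test_fn j (\<phi> z))) \<le> b" if "j \<in> {1..4}" for j
        using \<delta>(2)[of "\<phi> z" j] p that by simp
      have half: "1 / 2 \<le> cmod (\<phi> z)" using p by simp
      show "E1 z \<le> 544 * a + e" "E2 z \<le> 544 * a + e"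
        using E_le_test_fn[OF z half s] by (simp_all add: b_def)
    qed (use \<delta> in auto)
  qed
  show "limsup0 (phi_to_boundary \<phi>) (\<lambda>z. ereal (E1 z)) \<le> ereal (544 * a)"
  proof (rule ereal_le_epsilon2)
    fix e :: real assume e: "0 < e"
    have "limsup0 (phi_to_boundary \<phi>) (\<lambda>z. ereal (E1 z)) \<le> ereal (544 * a + e)"
      by (rule limsup0_le) (use a0 e ev[OF e] in \<open>auto elim!: eventually_mono\<close>)
    then show "limsup0 (phi_to_boundary \<phi>) (\<lambda>z. ereal (E1 z)) \<le> ereal (544 * a) + ereal e" by simp
  qed
  show "limsup0 (phi_to_boundary \<phi>) (\<lambda>z. ereal (E2 z)) \<le> ereal (544 * a)"
  proof (rule ereal_le_epsilon2)
    fix e :: real assume e: "0 < e"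
    have "limsup0 (phi_to_boundary \<phi>) (\<lambda>z. ereal (E2 z)) \<le> ereal (544 * a + e)"
      by (rule limsup0_le) (use a0 e ev[OF e] in \<open>auto elim!: eventually_mono\<close>)
    then show "limsup0 (phi_to_boundary \<phi>) (\<lambda>z. ereal (E2 z)) \<le> ereal (544 * a) + ereal e" by simp
  qed
qed

lemma ess_norm_le_E_lim:
  assumes "limsup0 (phi_to_boundary \<phi>) (\<lambda>z. ereal (E1 z)) = ereal l1"
    "limsup0 (phi_to_boundary \<phi>) (\<lambda>z. ereal (E2 z)) = ereal l2"
  shows "ess_norm_B1_Z \<alpha> T \<le> 256 * (l1 + l2)"
proof (rule field_le_epsilon)
  have "0 \<le> limsup0 F f" for F and f :: "complex \<Rightarrow> ereal" by (simp add: limsup0_def)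
  then have l: "0 \<le> l1" "0 \<le> l2" using assms by (metis ereal_less_eq(5))+
  fix e :: real assume e: "e > 0"
  \<comment> \<open>Strictly above both limsups, since each of \<open>l1\<close> and
    \<open>l2\<close> is nonnegative; 256 * b exceeds the target by exactly e.\<close>
  define b where "b = l1 + l2 + e / 256"
  have "eventually (\<lambda>z. ereal (E1 z) < ereal b) (phi_to_boundary \<phi>)"
    by (rule limsup0_lessD) (use assms l e in \<open>simp add: b_def\<close>)
  moreover have "eventually (\<lambda>z. ereal (E2 z) < ereal b) (phi_to_boundary \<phi>)"
    by (rule limsup0_lessD) (use assms l e in \<open>simp add: b_def\<close>)
  ultimately have "eventually (\<lambda>z. E1 z \<le> b \<and> E2 z \<le> b) (phi_to_boundary \<phi>)"
    by eventually_elim simp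
  then obtain \<delta> where \<delta>: "\<delta> < 1" "\<And>z. z \<in> disc \<Longrightarrow> \<delta> < cmod (\<phi> z) \<Longrightarrow> cmod (\<phi> z) < 1 \<Longrightarrow> E1 z \<le> b \<and> E2 z \<le> b"
    unfolding eventually_phi_to_boundary by blast
  have p: "cmod (\<phi> z) < 1" if "z \<in> disc" for z using \<phi>_disc[OF that] by simp
  have "ess_norm_B1_Z \<alpha> T \<le> 256 * b"
    \<comment> \<open>The level is raised to include |\<phi> 0|, which is below 1, to control the
      origin terms.\<close>
    by (rule ess_norm_upper[of "max \<delta> (cmod (\<phi> 0))"]) (use \<delta> p l e in \<open>auto simp: b_def le_max_iff_disj\<close>)
  then show "ess_norm_B1_Z \<alpha> T \<le> 256 * (l1 + l2) + e" by (simp add: b_def)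
qed

end

theorem theorem3p3:
  fixes \<alpha> :: real
  assumes "\<alpha> > 0"
  shows "\<exists>c C. c > 0 \<and> C > 0 \<and>
    (\<forall>u v \<phi> :: complex \<Rightarrow> complex.
       u holomorphic_on disc \<and> v holomorphic_on disc \<and> \<phi> holomorphic_on disc \<and>
       \<phi> ` disc \<subseteq> disc \<and> bounded_B1_Z \<alpha> (Tuvphi u v \<phi>) \<longrightarrow>
       (let E = ereal (ess_norm_B1_Z \<alpha> (Tuvphi u v \<phi>));
            A = Max ((\<lambda>j. limsup0 to_boundary
                        (\<lambda>a. ereal (Z_norm \<alpha> (Tuvphi u v \<phi> (test_fn j a))))) ` {1..4});
            B = limsup0 (phi_to_boundary \<phi>)
                  (\<lambda>z. ereal ((1 - (cmod z)\<^sup>2) powr \<alpha> *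
                     (cmod (deriv (deriv u) z)
                      + cmod (2 * deriv u z * deriv \<phi> z + u z * deriv (deriv \<phi>) z
                              + deriv (deriv v) z) / (1 - (cmod (\<phi> z))\<^sup>2))))
              + limsup0 (phi_to_boundary \<phi>)
                  (\<lambda>z. ereal ((1 - (cmod z)\<^sup>2) powr \<alpha> *
                     (cmod (u z * (deriv \<phi> z)\<^sup>2 + 2 * deriv v z * deriv \<phi> z
                            + v z * deriv (deriv \<phi>) z) / (1 - (cmod (\<phi> z))\<^sup>2)\<^sup>2
                      + cmod (v z * (deriv \<phi> z)\<^sup>2) / (1 - (cmod (\<phi> z))\<^sup>2) ^ 3)))
        in ereal c * A \<le> E \<and> E \<le> ereal C * A \<and>
           ereal c * B \<le> E \<and> E \<le> ereal C * B))"
proof (rule exI[of _ "1 / (6000 * 1088)"], rule exI[of _ "256 * 1088"], intro conjI allI impI)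
  fix u v \<phi> :: "complex \<Rightarrow> complex"
  assume *: "u holomorphic_on disc \<and> v holomorphic_on disc \<and> \<phi> holomorphic_on disc \<and>
    \<phi> ` disc \<subseteq> disc \<and> bounded_B1_Z \<alpha> (Tuvphi u v \<phi>)"
  then obtain M0 where M0: "\<And>f. f \<in> B1 \<Longrightarrow> Z_norm \<alpha> (Tuvphi u v \<phi> f) \<le> M0 * B1_norm f"
    unfolding bounded_B1_Z_def by blast
  \<comment> \<open>Replacing \<open>M0\<close> by |M0| + 1 gives a positive bound, as the locale
    demands.\<close>
  have M: "Z_norm \<alpha> (Tuvphi u v \<phi> f) \<le> (\<bar>M0\<bar> + 1) * B1_norm f" if "f \<in> B1" for f
    using M0[OF that] mult_right_mono[of M0 "\<bar>M0\<bar> + 1" "B1_norm f"] B1_norm_nonneg[of f] by linarith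
  have p: "\<phi> z \<in> disc" if "z \<in> disc" for z using * that by blast
  interpret bounded_operator \<alpha> u v \<phi> "\<bar>M0\<bar> + 1"
    by unfold_locales (use * M p in \<open>simp_all add: bounded_B1_Z_def\<close>)
  define L1 L2 where "L1 = limsup0 (phi_to_boundary \<phi>) (\<lambda>z. ereal (E1 z))"
    and "L2 = limsup0 (phi_to_boundary \<phi>) (\<lambda>z. ereal (E2 z))"
  define e where "e = ess_norm_B1_Z \<alpha> T"
  \<comment> \<open>Nonnegative and below a real number, hence finite; the same argument then makes
    both coefficient limsups real.\<close>
  obtain a where a: "A_lim = ereal a"
    using A_lim_le_ess_norm A_lim_nonneg by (cases A_lim) auto
  have ae: "0 \<le> a" "a \<le> 6000 * e"
    using A_lim_le_ess_norm A_lim_nonneg by (simp_all add: a e_def)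
  have L: "L1 \<le> ereal (544 * a)" "L2 \<le> ereal (544 * a)" "0 \<le> L1" "0 \<le> L2"
    using E_lim_le_A_lim[OF a] by (simp_all add: L1_def L2_def limsup0_def)
  obtain l1 where l1: "L1 = ereal l1" using L(1,3) by (cases L1) auto
  obtain l2 where l2: "L2 = ereal l2" using L(2,4) by (cases L2) auto
  have l: "0 \<le> l1" "0 \<le> l2" "l1 \<le> 544 * a" "l2 \<le> 544 * a" using L by (simp_all add: l1 l2)
  have el: "e \<le> 256 * (l1 + l2)"
    unfolding e_def by (rule ess_norm_le_E_lim) (use l1 l2 in \<open>simp_all add: L1_def L2_def\<close>)
  \<comment> \<open>The cycle closes: a <= 6000 e, e <= 256 (l1 + l2) and l1 + l2 <= 2 * 544 a =
    1088 a. So e <= 256 * 1088 a and l1 + l2 <= 1088 * 6000 e, and the weaker constant of each kind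
    serves both comparisons.\<close>
  have main: "ereal (1 / (6000 * 1088)) * A_lim \<le> ereal e \<and> ereal e \<le> ereal (256 * 1088) * A_lim \<and>
    ereal (1 / (6000 * 1088)) * (L1 + L2) \<le> ereal e \<and> ereal e \<le> ereal (256 * 1088) * (L1 + L2)"
    using ae l el by (simp add: a l1 l2)
  show "let E = ereal (ess_norm_B1_Z \<alpha> (Tuvphi u v \<phi>));
            A = Max ((\<lambda>j. limsup0 to_boundary
                        (\<lambda>a. ereal (Z_norm \<alpha> (Tuvphi u v \<phi> (test_fn j a))))) ` {1..4});
            B = limsup0 (phi_to_boundary \<phi>)
                  (\<lambda>z. ereal ((1 - (cmod z)\<^sup>2) powr \<alpha> *
                     (cmod (deriv (deriv u) z)
                      + cmod (2 * deriv u z * deriv \<phi> z + u z * deriv (deriv \<phi>) z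
                              + deriv (deriv v) z) / (1 - (cmod (\<phi> z))\<^sup>2))))
              + limsup0 (phi_to_boundary \<phi>)
                  (\<lambda>z. ereal ((1 - (cmod z)\<^sup>2) powr \<alpha> *
                     (cmod (u z * (deriv \<phi> z)\<^sup>2 + 2 * deriv v z * deriv \<phi> z
                            + v z * deriv (deriv \<phi>) z) / (1 - (cmod (\<phi> z))\<^sup>2)\<^sup>2
                      + cmod (v z * (deriv \<phi> z)\<^sup>2) / (1 - (cmod (\<phi> z))\<^sup>2) ^ 3)))
        in ereal (1 / (6000 * 1088)) * A \<le> E \<and> E \<le> ereal (256 * 1088) * A \<and>
           ereal (1 / (6000 * 1088)) * B \<le> E \<and> E \<le> ereal (256 * 1088) * B"
    using main unfolding Let_def A_lim_def e_def L1_def L2_def E1_def E2_def .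
qed simp_all

end
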